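(* The bialgebra $\mathfrak M\mathrm{MR}$ has an antipode, making it a Hopf algebra.
   Context: A set composition of a finite set $S$ of positive integers is a word $w=w_1\cdots w_k$ of nonempty pairwise disjoint sets with union $S$. An $\mathfrak M$-permutation of $[n]$ is a set composition $w=w_1\cdots w_k$ of $[n]$ such that no $w_i$ contains two consecutive integers. $S^{\mathfrak M}_n$ is the set of these, $S^{\mathfrak M}_0=\{\emptyset\}$, $S^{\mathfrak M}_\infty=\bigcup_n S^{\mathfrak M}_n$. $\mathfrak M\mathrm{MR}=\bigoplus_{w\in S^{\mathfrak M}_\infty}\mathbb Z w$ (finite linear combinations). Standardization: for a set composition $w$ of $S$, $\mathrm{st}(w)\in S^{\mathfrak M}_\infty$ is obtained by repeating the following until an $\mathfrak M$-permutation results: (R1) delete the letter $i+1$ if both $i$ and $i+1$ belong to some $w_j$; (R2) reduce all letters larger than $i$ by $1$ if the positive integer $i$ is not present in any $w_j$. Restriction: for $T\subset S$, $w|_T$ is obtained by intersecting each $w_i$ with $T$ and removing the sets that become empty. Product: for $w\in S^{\mathfrak M}_m$, $u\in S^{\mathfrak M}_n$, $w\bullet u=\sum v$, over (1) all $v\in S^{\mathfrak M}_{m+n}$ with $v|_{[m]}=w$ and $\mathrm{st}(v|_{[m+1,m+n]})=u$; and (2) all $v\in S^{\mathfrak M}_{m+n-1}$ with $v|_{[m]}=w$ and $\mathrm{st}(v|_{[m,m+n-1]})=u$; extended bilinearly. Coproduct: $\vartriangle w=\sum_{[u,v]=w}\mathrm{st}(u)\otimes\mathrm{st}(v)$, over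 all pairs $(u,v)$ of (possibly empty) set compositions whose concatenation is $w$. Unit: $\eta(1)=\emptyset$. Counit: $\varepsilon$ takes the coefficient of $\emptyset$. With these data $\mathfrak M\mathrm{MR}$ is a bialgebra. *)

theory Defs
  imports Complex_Main "HOL-Library.Poly_Mapping"
begin

section \<open>Bialgebras and Hopf algebras on free \<int>-modules\<close>

text \<open>
  The free \<int>-module on a basis \<open>'a\<close> is \<open>'a \<Rightarrow>\<^sub>0 int\<close>, with basis elements \<open>frag_of x\<close> and
  linear extension \<open>frag_extend\<close>. The tensor product of the free modules on \<open>'a\<close> and \<open>'b\<close>
  is taken to be the free module on \<open>'a \<times> 'b\<close>, the basis element \<open>(x, y)\<close> standing
  for \<open>x \<otimes> y\<close>. A \<int>-linear map is the same thing as an additive map.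
\<close>

definition tensor :: "('a \<Rightarrow>\<^sub>0 int) \<Rightarrow> ('b \<Rightarrow>\<^sub>0 int) \<Rightarrow> ('a \<times> 'b \<Rightarrow>\<^sub>0 int)" where
  "tensor a b = frag_extend (\<lambda>x. frag_extend (\<lambda>y. frag_of (x, y)) b) a"

definition tensor_map ::
  "(('a \<Rightarrow>\<^sub>0 int) \<Rightarrow> ('c \<Rightarrow>\<^sub>0 int)) \<Rightarrow> (('b \<Rightarrow>\<^sub>0 int) \<Rightarrow> ('d \<Rightarrow>\<^sub>0 int))
    \<Rightarrow> ('a \<times> 'b \<Rightarrow>\<^sub>0 int) \<Rightarrow> ('c \<times> 'd \<Rightarrow>\<^sub>0 int)" where
  "tensor_map f g = frag_extend (\<lambda>(x, y). tensor (f (frag_of x)) (g (frag_of y)))"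

text \<open>The isomorphism \<open>(A \<otimes> B) \<otimes> C \<cong> A \<otimes> (B \<otimes> C)\<close>.\<close>

definition tensor_assoc :: "(('a \<times> 'b) \<times> 'c \<Rightarrow>\<^sub>0 int) \<Rightarrow> ('a \<times> ('b \<times> 'c) \<Rightarrow>\<^sub>0 int)" where
  "tensor_assoc = frag_extend (\<lambda>((x, y), z). frag_of (x, (y, z)))"

text \<open>The linear map \<open>A \<otimes> B \<rightarrow> C\<close> induced by a bilinear map \<open>A \<times> B \<rightarrow> C\<close>.\<close>

definition tensor_lift ::
  "(('a \<Rightarrow>\<^sub>0 int) \<Rightarrow> ('b \<Rightarrow>\<^sub>0 int) \<Rightarrow> ('c \<Rightarrow>\<^sub>0 int)) \<Rightarrow> ('a \<times> 'b \<Rightarrow>\<^sub>0 int) \<Rightarrow> ('c \<Rightarrow>\<^sub>0 int)" where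
  "tensor_lift f = frag_extend (\<lambda>(x, y). f (frag_of x) (frag_of y))"

text \<open>The product \<open>(x \<otimes> y) (x' \<otimes> y') = x x' \<otimes> y y'\<close> on \<open>A \<otimes> A\<close>.\<close>

definition tensor_mult ::
  "(('a \<Rightarrow>\<^sub>0 int) \<Rightarrow> ('a \<Rightarrow>\<^sub>0 int) \<Rightarrow> ('a \<Rightarrow>\<^sub>0 int))
    \<Rightarrow> ('a \<times> 'a \<Rightarrow>\<^sub>0 int) \<Rightarrow> ('a \<times> 'a \<Rightarrow>\<^sub>0 int) \<Rightarrow> ('a \<times> 'a \<Rightarrow>\<^sub>0 int)" where
  "tensor_mult m s t =
     frag_extend (\<lambda>(x, y). frag_extend (\<lambda>(x', y').
       tensor (m (frag_of x) (frag_of x')) (m (frag_of y) (frag_of y'))) t) s"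

locale free_algebra =
  fixes mult :: "('a \<Rightarrow>\<^sub>0 int) \<Rightarrow> ('a \<Rightarrow>\<^sub>0 int) \<Rightarrow> ('a \<Rightarrow>\<^sub>0 int)"
    and unit :: "int \<Rightarrow> ('a \<Rightarrow>\<^sub>0 int)"
  assumes mult_linear_left: "\<And>b. additive (\<lambda>a. mult a b)"
    and mult_linear_right: "\<And>a. additive (\<lambda>b. mult a b)"
    and unit_linear: "additive unit"
    and mult_assoc: "\<And>a b c. mult (mult a b) c = mult a (mult b c)"
    and unit_left: "\<And>a. mult (unit 1) a = a"
    and unit_right: "\<And>a. mult a (unit 1) = a"

text \<open>
  The counit axioms use the identifications \<open>\<int> \<otimes> A \<cong> A \<cong> A \<otimes> \<int>\<close>, under which
  \<open>(counit \<otimes> id) (x \<otimes> y)\<close> is \<open>counit x \<cdot> y\<close> and \<open>(id \<otimes> counit) (x \<otimes> y)\<close> is \<open>counit y \<cdot> x\<close>.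
\<close>

locale free_coalgebra =
  fixes comult :: "('a \<Rightarrow>\<^sub>0 int) \<Rightarrow> ('a \<times> 'a \<Rightarrow>\<^sub>0 int)"
    and counit :: "('a \<Rightarrow>\<^sub>0 int) \<Rightarrow> int"
  assumes comult_linear: "additive comult"
    and counit_linear: "additive counit"
    and coassoc: "\<And>a. tensor_assoc (tensor_map comult id (comult a)) = tensor_map id comult (comult a)"
    and counit_left: "\<And>a. tensor_lift (\<lambda>x y. frag_cmul (counit x) y) (comult a) = a"
    and counit_right: "\<And>a. tensor_lift (\<lambda>x y. frag_cmul (counit y) x) (comult a) = a"

locale free_bialgebra = free_algebra mult unit + free_coalgebra comult counit
  for mult :: "('a \<Rightarrow>\<^sub>0 int) \<Rightarrow> ('a \<Rightarrow>\<^sub>0 int) \<Rightarrow> ('a \<Rightarrow>\<^sub>0 int)"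
    and unit :: "int \<Rightarrow> ('a \<Rightarrow>\<^sub>0 int)"
    and comult :: "('a \<Rightarrow>\<^sub>0 int) \<Rightarrow> ('a \<times> 'a \<Rightarrow>\<^sub>0 int)"
    and counit :: "('a \<Rightarrow>\<^sub>0 int) \<Rightarrow> int" +
  assumes comult_mult: "\<And>a b. comult (mult a b) = tensor_mult mult (comult a) (comult b)"
    and comult_unit: "comult (unit 1) = tensor (unit 1) (unit 1)"
    and counit_mult: "\<And>a b. counit (mult a b) = counit a * counit b"
    and counit_unit: "counit (unit 1) = 1"

locale free_Hopf_algebra = free_bialgebra mult unit comult counit
  for mult :: "('a \<Rightarrow>\<^sub>0 int) \<Rightarrow> ('a \<Rightarrow>\<^sub>0 int) \<Rightarrow> ('a \<Rightarrow>\<^sub>0 int)"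
    and unit :: "int \<Rightarrow> ('a \<Rightarrow>\<^sub>0 int)"
    and comult :: "('a \<Rightarrow>\<^sub>0 int) \<Rightarrow> ('a \<times> 'a \<Rightarrow>\<^sub>0 int)"
    and counit :: "('a \<Rightarrow>\<^sub>0 int) \<Rightarrow> int" +
  fixes antipode :: "('a \<Rightarrow>\<^sub>0 int) \<Rightarrow> ('a \<Rightarrow>\<^sub>0 int)"
  assumes antipode_linear: "additive antipode"
    and antipode_left: "\<And>a. tensor_lift mult (tensor_map antipode id (comult a)) = unit (counit a)"
    and antipode_right: "\<And>a. tensor_lift mult (tensor_map id antipode (comult a)) = unit (counit a)"


section \<open>Set compositions and \<open>\<MM>\<close>-permutations\<close>

definition set_composition :: "nat set \<Rightarrow> nat set list \<Rightarrow> bool" where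
  "set_composition S w \<longleftrightarrow>
     finite S \<and> 0 \<notin> S \<and> {} \<notin> set w \<and> sorted_wrt disjnt w \<and> \<Union>(set w) = S"

definition M_perms :: "nat \<Rightarrow> nat set list set" where
  "M_perms n = {w. set_composition {1..n} w \<and> (\<forall>B\<in>set w. \<forall>i. \<not> (i \<in> B \<and> Suc i \<in> B))}"

typedef mperm = "\<Union>n. M_perms n"
  morphisms word_of mperm_of
proof
  show "[] \<in> (\<Union>n. M_perms n)"
    by (auto simp: M_perms_def set_composition_def intro!: exI[of _ 0])
qed

text \<open>The \<open>n\<close> with \<open>word_of w \<in> M_perms n\<close>, as the letters of \<open>w\<close> are exactly \<open>1, \<dots>, n\<close>.\<close>

definition mdeg :: "mperm \<Rightarrow> nat" where
  "mdeg w = card (\<Union>(set (word_of w)))"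

definition restriction :: "nat set list \<Rightarrow> nat set \<Rightarrow> nat set list" where
  "restriction w T = filter (\<lambda>B. B \<noteq> {}) (map (\<lambda>B. B \<inter> T) w)"

text \<open>
  One application of rule R1 or R2. The blocks of a set composition are disjoint, so in
  \<open>R1\<close> the letter \<open>i + 1\<close> disappears from the block \<open>B\<close> only.
\<close>

inductive st_step :: "nat set list \<Rightarrow> nat set list \<Rightarrow> bool" where
  R1: "\<lbrakk>B \<in> set w; i \<in> B; Suc i \<in> B\<rbrakk> \<Longrightarrow> st_step w (map (\<lambda>C. C - {Suc i}) w)"
| R2: "\<lbrakk>0 < i; i \<notin> \<Union>(set w)\<rbrakk> \<Longrightarrow> st_step w (map ((`) (\<lambda>x. if i < x then x - 1 else x)) w)"

text \<open>
  Only meaningful for set compositions \<open>w\<close>: then exactly one \<open>\<MM>\<close>-permutation is reachable,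
  since the steps neither change the number of blocks nor, up to collapsing adjacent
  repetitions, the sequence of positions of the blocks containing the successive letters.
\<close>

definition st :: "nat set list \<Rightarrow> mperm" where
  "st w = (THE p. st_step\<^sup>*\<^sup>* w (word_of p))"


section \<open>The bialgebra \<open>\<MM>MR\<close>\<close>

type_synonym MMR = "mperm \<Rightarrow>\<^sub>0 int"

text \<open>
  The two families of terms in \<open>w \<bullet> u\<close>. The premise \<open>0 < m + n\<close> in the second one only matters for
  \<open>m = n = 0\<close>, where \<open>m + n - 1\<close> is \<open>-1\<close> and the family is empty.
\<close>

definition prod_terms1 :: "mperm \<Rightarrow> mperm \<Rightarrow> mperm set" where
  "prod_terms1 w u = (let m = mdeg w; n = mdeg u in
     {v. word_of v \<in> M_perms (m + n) \<and>
         restriction (word_of v) {1..m} = word_of w \<and>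
         st (restriction (word_of v) {m+1..m+n}) = u})"

definition prod_terms2 :: "mperm \<Rightarrow> mperm \<Rightarrow> mperm set" where
  "prod_terms2 w u = (let m = mdeg w; n = mdeg u in
     {v. 0 < m + n \<and> word_of v \<in> M_perms (m + n - 1) \<and>
         restriction (word_of v) {1..m} = word_of w \<and>
         st (restriction (word_of v) {m..m+n-1}) = u})"

definition basis_mult :: "mperm \<Rightarrow> mperm \<Rightarrow> MMR" where
  "basis_mult w u = (\<Sum>v\<in>prod_terms1 w u. frag_of v) + (\<Sum>v\<in>prod_terms2 w u. frag_of v)"

definition MMR_mult :: "MMR \<Rightarrow> MMR \<Rightarrow> MMR" where
  "MMR_mult a b = frag_extend (\<lambda>w. frag_extend (\<lambda>u. basis_mult w u) b) a"

definition MMR_unit :: "int \<Rightarrow> MMR" where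
  "MMR_unit c = frag_cmul c (frag_of (mperm_of []))"

definition basis_comult :: "mperm \<Rightarrow> (mperm \<times> mperm \<Rightarrow>\<^sub>0 int)" where
  "basis_comult w = (\<Sum>(u, v)\<in>{(u, v). u @ v = word_of w}. frag_of (st u, st v))"

definition MMR_comult :: "MMR \<Rightarrow> (mperm \<times> mperm \<Rightarrow>\<^sub>0 int)" where
  "MMR_comult = frag_extend basis_comult"

definition MMR_counit :: "MMR \<Rightarrow> int" where
  "MMR_counit a = Poly_Mapping.lookup a (mperm_of [])"

end

theory Submission
  imports Defs
begin

text \<open>
  Reading off, for each letter in turn, the position of the block containing it turns an
  \<open>\<MM>\<close>-permutation into a word without adjacent repetitions, up to order isomorphism of the
  alphabet; standardization collapses adjacent repetitions. Words without adjacent repetitions form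
  the free monoid on idempotent generators, and the coefficient of a word \<open>v\<close> in \<open>a \<bullet> b\<close> is the sum of
  \<open>a(x) b(y)\<close> over the factorizations \<open>v = x y\<close> in this monoid. The coefficient of \<open>p \<otimes> q\<close> in the
  coproduct of \<open>a\<close>, with the letters of \<open>p\<close> smaller than those of \<open>q\<close>, is the sum of \<open>a(v)\<close> over the
  words \<open>v\<close> that project to \<open>p\<close> and \<open>q\<close>. In this form the bialgebra axioms become bijections between
  sets of words. The number of blocks makes the coalgebra connected, so the antipode is obtained
  recursively as a convolution inverse of the identity.
\<close>

section \<open>Linear maps on free modules\<close>

text \<open>Because the generators are idempotent, infinitely many words can project to the same two
  words. The formula for the coproduct is a finite sum only thanks to the finite support of its
  argument, so a bound on the length of words is carried along. Words represent \<MM>-permutations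
  only up to an increasing renaming of letters. Fixing \<open>p\<close> and \<open>q\<close> over
  separated alphabets removes this freedom: an increasing map of a finite alphabet onto itself is
  the identity, hence a basis element has at most one representative among the words that are
  counted. The number of letters is not additive under cutting, since standardizing a piece may
  merge letters; the number of blocks is additive, which is why it governs the recursion for the
  antipode.\<close>

lemma additive_eqI:
  fixes f g :: "('a \<Rightarrow>\<^sub>0 int) \<Rightarrow> 'b::ab_group_add"
  assumes "additive f" "additive g" "\<And>x. f (frag_of x) = g (frag_of x)"
  shows "f a = g a"
proof -
  have "Poly_Mapping.keys a \<subseteq> UNIV" by simp
  then show ?thesis
  proof (induction a rule: frag_induction)
    case zero
    show ?case using assms(1,2) by (simp add: additive.zero)
  next
    case (one x)
    show ?case by (rule assms(3))
  next
    case (diff a b)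
    then show ?case using assms(1,2) by (simp add: additive.diff)
  qed
qed

lemma additive_frag_extend: "additive (frag_extend F)"
  by unfold_locales (rule frag_extend_add)

lemma additive_frag_extend_fun:
  assumes "\<And>x. additive (F x)"
  shows "additive (\<lambda>b. frag_extend (\<lambda>x. F x b) a)"
  by unfold_locales
    (simp add: frag_extend_def additive.add[OF assms] frag_cmul_distrib2 sum.distrib)

lemma frag_extend_fun_add: "frag_extend (\<lambda>x. F x + G x) a = frag_extend F a + frag_extend G a"
  by (simp add: frag_extend_def frag_cmul_distrib2 sum.distrib)

lemma additive_compose:
  assumes "additive f" "additive g"
  shows "additive (\<lambda>x. f (g x))"
  using assms by (simp add: additive_def)

lemma additive_id: "additive id" "additive (\<lambda>x. x)"
  by (simp_all add: additive_def)

lemma additive_lookup: "additive (\<lambda>a. Poly_Mapping.lookup a x)"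
  by unfold_locales (rule lookup_add)

lemma additive_mult_left: "additive f \<Longrightarrow> additive (\<lambda>x. c * f x :: int)"
  by (simp add: additive_def distrib_left)

lemma additive_mult_right: "additive f \<Longrightarrow> additive (\<lambda>x. f x * c :: int)"
  by (simp add: additive_def distrib_right)

lemma additive_sum:
  assumes "\<And>i. i \<in> I \<Longrightarrow> additive (F i)"
  shows "additive (\<lambda>x. \<Sum>i\<in>I. F i x)"
  using assms by (simp add: additive_def sum.distrib)

lemma additive_cmul:
  fixes f :: "('a \<Rightarrow>\<^sub>0 int) \<Rightarrow> ('b \<Rightarrow>\<^sub>0 int)"
  assumes "additive f"
  shows "f (frag_cmul c b) = frag_cmul c (f b)"
  by (induction c rule: int_induct[where k = 0])
    (simp_all add: frag_cmul_distrib frag_cmul_diff_distrib additive.add[OF assms]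
      additive.diff[OF assms] additive.zero[OF assms])

lemma additive_frag_extend_eq:
  assumes "additive f"
  shows "frag_extend (\<lambda>x. f (F x)) a = f (frag_extend F a)"
  by (rule additive_eqI[OF additive_frag_extend additive_compose[OF assms additive_frag_extend]]) simp

lemma additive_tensor_left: "additive (\<lambda>a. tensor a b)"
  unfolding tensor_def by (rule additive_frag_extend)

lemma additive_tensor_right: "additive (\<lambda>b. tensor a b)"
  unfolding tensor_def by (rule additive_frag_extend_fun) (rule additive_frag_extend)

lemma tensor_of [simp]: "tensor (frag_of x) (frag_of y) = frag_of (x, y)"
  by (simp add: tensor_def)

lemma tensor_map_of: "tensor_map f g (frag_of (x, y)) = tensor (f (frag_of x)) (g (frag_of y))"
  by (simp add: tensor_map_def)

lemma additive_tensor_map: "additive (tensor_map f g)"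
  unfolding tensor_map_def by (rule additive_frag_extend)

lemma tensor_lift_of [simp]: "tensor_lift f (frag_of (x, y)) = f (frag_of x) (frag_of y)"
  by (simp add: tensor_lift_def)

lemma additive_tensor_lift: "additive (tensor_lift f)"
  unfolding tensor_lift_def by (rule additive_frag_extend)

lemma tensor_assoc_of [simp]: "tensor_assoc (frag_of ((x, y), z)) = frag_of (x, (y, z))"
  by (simp add: tensor_assoc_def)

lemma additive_tensor_assoc: "additive tensor_assoc"
  unfolding tensor_assoc_def by (rule additive_frag_extend)

lemma lookup_tensor:
  "Poly_Mapping.lookup (tensor a b) (x, y) = Poly_Mapping.lookup a x * Poly_Mapping.lookup b y"
proof (rule additive_eqI[of "\<lambda>a. Poly_Mapping.lookup (tensor a b) (x, y)"])
  fix x'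
  show "Poly_Mapping.lookup (tensor (frag_of x') b) (x, y)
    = Poly_Mapping.lookup (frag_of x') x * Poly_Mapping.lookup b y"
    by (rule additive_eqI[OF additive_compose[OF additive_lookup additive_tensor_right]
          additive_mult_left[OF additive_lookup]])
      (auto simp: lookup_single when_def)
qed (auto intro: additive_compose[OF additive_lookup additive_tensor_left]
         additive_mult_right additive_lookup)

lemma tensor_lift_tensor:
  assumes "\<And>b. additive (\<lambda>a. m a b)" "\<And>a. additive (\<lambda>b. m a b)"
  shows "tensor_lift m (tensor a b) = m a b"
proof (rule additive_eqI[of "\<lambda>a. tensor_lift m (tensor a b)"])
  fix x
  show "tensor_lift m (tensor (frag_of x) b) = m (frag_of x) b"
    by (rule additive_eqI[of "\<lambda>b. tensor_lift m (tensor (frag_of x) b)"])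
      (auto intro: additive_compose[OF additive_tensor_lift additive_tensor_right] assms)
qed (auto intro: additive_compose[OF additive_tensor_lift additive_tensor_left] assms)

lemma additive_tensor_mult:
  "additive (\<lambda>s. tensor_mult m s t)" "additive (\<lambda>t. tensor_mult m s t)"
proof -
  show "additive (\<lambda>s. tensor_mult m s t)"
    unfolding tensor_mult_def by (rule additive_frag_extend)
  show "additive (\<lambda>t. tensor_mult m s t)"
    unfolding tensor_mult_def
    by (rule additive_frag_extend_fun) (simp add: split_beta additive_frag_extend)
qed

lemma tensor_mult_of:
  "tensor_mult m (frag_of (x, y)) (frag_of (x', y'))
    = tensor (m (frag_of x) (frag_of x')) (m (frag_of y) (frag_of y'))"
  by (simp add: tensor_mult_def)

section \<open>Convolution and the antipode of a connected bialgebra\<close>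

context free_bialgebra
begin

definition convolution :: "(('a \<Rightarrow>\<^sub>0 int) \<Rightarrow> ('a \<Rightarrow>\<^sub>0 int)) \<Rightarrow> (('a \<Rightarrow>\<^sub>0 int) \<Rightarrow> ('a \<Rightarrow>\<^sub>0 int))
    \<Rightarrow> ('a \<Rightarrow>\<^sub>0 int) \<Rightarrow> ('a \<Rightarrow>\<^sub>0 int)" where
  "convolution f g a = tensor_lift mult (tensor_map f g (comult a))"

lemma lift_map_of:
  "tensor_lift mult (tensor_map f g (frag_of (x, y))) = mult (f (frag_of x)) (g (frag_of y))"
  by (simp add: tensor_map_of tensor_lift_tensor[OF mult_linear_left mult_linear_right])

lemma additive_lift_map: "additive (\<lambda>t. tensor_lift mult (tensor_map f g t))"
  by (rule additive_compose[OF additive_tensor_lift additive_tensor_map])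

lemma additive_convolution: "additive (convolution f g)"
  unfolding convolution_def by (rule additive_compose[OF additive_lift_map comult_linear])

lemma lift_map_eq:
  "tensor_lift mult (tensor_map f g t)
    = frag_extend (\<lambda>(x, y). mult (f (frag_of x)) (g (frag_of y))) t"
  by (rule additive_eqI[OF additive_lift_map additive_frag_extend]) (auto simp: lift_map_of)

lemma convolution_eq:
  "convolution f g a = frag_extend (\<lambda>(x, y). mult (f (frag_of x)) (g (frag_of y))) (comult a)"
  by (simp add: convolution_def lift_map_eq)

text \<open>Both sides are the threefold product \<open>L\<close> applied to an iterated coproduct,
  once in each bracketing, and coassociativity identifies the two iterated coproducts.\<close>

lemma convolution_assoc:
  assumes "additive f" "additive g" "additive h"
  shows "convolution (convolution f g) h a = convolution f (convolution g h) a"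
proof -
  define L where "L = frag_extend
    (\<lambda>(x, (y, z)). mult (mult (f (frag_of x)) (g (frag_of y))) (h (frag_of z)))"
  have L: "additive L" unfolding L_def by (rule additive_frag_extend)
  have left: "tensor_lift mult (tensor_map (convolution f g) h t)
      = L (tensor_assoc (tensor_map comult id t))" for t
  proof (rule additive_eqI[OF additive_lift_map])
    show "additive (\<lambda>t. L (tensor_assoc (tensor_map comult id t)))"
      by (intro additive_compose[OF L] additive_compose[OF additive_tensor_assoc] additive_tensor_map)
    fix p :: "'a \<times> 'a"
    obtain x z where p: "p = (x, z)" by force
    have "mult (tensor_lift mult (tensor_map f g s)) (h (frag_of z))
        = L (tensor_assoc (tensor s (frag_of z)))" for s
      by (rule additive_eqI[of "\<lambda>s. mult (tensor_lift mult (tensor_map f g s)) (h (frag_of z))"])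
        (auto simp: lift_map_of L_def intro!: additive_compose[OF mult_linear_left] additive_lift_map
          additive_compose[OF additive_frag_extend] additive_compose[OF additive_tensor_assoc]
          additive_tensor_left)
    from this[of "comult (frag_of x)"]
    show "tensor_lift mult (tensor_map (convolution f g) h (frag_of p))
        = L (tensor_assoc (tensor_map comult id (frag_of p)))"
      unfolding p lift_map_of convolution_def[symmetric] by (simp add: tensor_map_of)
  qed
  have right: "tensor_lift mult (tensor_map f (convolution g h) t) = L (tensor_map id comult t)" for t
  proof (rule additive_eqI[OF additive_lift_map])
    show "additive (\<lambda>t. L (tensor_map id comult t))"
      by (intro additive_compose[OF L] additive_tensor_map)
    fix p :: "'a \<times> 'a"
    obtain x z where p: "p = (x, z)" by force
    have "mult (f (frag_of x)) (tensor_lift mult (tensor_map g h s)) = L (tensor (frag_of x) s)" for s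
      by (rule additive_eqI[of "\<lambda>s. mult (f (frag_of x)) (tensor_lift mult (tensor_map g h s))"])
        (auto simp: lift_map_of L_def mult_assoc intro!: additive_compose[OF mult_linear_right]
          additive_lift_map additive_compose[OF additive_frag_extend] additive_tensor_right)
    from this[of "comult (frag_of z)"]
    show "tensor_lift mult (tensor_map f (convolution g h) (frag_of p))
        = L (tensor_map id comult (frag_of p))"
      unfolding p lift_map_of convolution_def[symmetric] by (simp add: tensor_map_of)
  qed
  have "convolution (convolution f g) h a = L (tensor_assoc (tensor_map comult id (comult a)))"
    by (simp add: left[symmetric] convolution_def)
  also have "\<dots> = convolution f (convolution g h) a"
    by (simp only: coassoc right[symmetric] convolution_def)
  finally show ?thesis .
qed

lemma unit_eq: "unit c = frag_cmul c (unit 1)"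
proof (induction c rule: int_induct[where k = 0])
  case base
  show ?case using additive.zero[OF unit_linear] by simp
next
  case (step1 i)
  then show ?case by (simp add: additive.add[OF unit_linear] frag_cmul_distrib)
next
  case (step2 i)
  then show ?case by (simp add: additive.diff[OF unit_linear] frag_cmul_diff_distrib)
qed

lemma mult_frag_cmul:
  "mult (frag_cmul c a) b = frag_cmul c (mult a b)"
  "mult a (frag_cmul c b) = frag_cmul c (mult a b)"
  by (rule additive_cmul[OF mult_linear_left] additive_cmul[OF mult_linear_right])+

lemma convolution_unit_left:
  assumes "additive f"
  shows "convolution (\<lambda>a. unit (counit a)) f a = f a"
proof -
  have "convolution (\<lambda>a. unit (counit a)) f a
      = f (tensor_lift (\<lambda>x y. frag_cmul (counit x) y) (comult a))"
    unfolding convolution_def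
  proof (rule additive_eqI[of "\<lambda>t. tensor_lift mult (tensor_map (\<lambda>a. unit (counit a)) f t)"])
    fix p :: "'a \<times> 'a"
    obtain x y where p: "p = (x, y)" by force
    show "tensor_lift mult (tensor_map (\<lambda>a. unit (counit a)) f (frag_of p))
        = f (tensor_lift (\<lambda>x y. frag_cmul (counit x) y) (frag_of p))"
      unfolding p lift_map_of
      by (subst unit_eq) (simp add: mult_frag_cmul unit_left additive_cmul[OF assms])
  qed (intro additive_lift_map additive_compose[OF assms] additive_tensor_lift)+
  then show ?thesis by (simp add: counit_left)
qed

lemma convolution_unit_right:
  assumes "additive f"
  shows "convolution f (\<lambda>a. unit (counit a)) a = f a"
proof -
  have "convolution f (\<lambda>a. unit (counit a)) a
      = f (tensor_lift (\<lambda>x y. frag_cmul (counit y) x) (comult a))"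
    unfolding convolution_def
  proof (rule additive_eqI[of "\<lambda>t. tensor_lift mult (tensor_map f (\<lambda>a. unit (counit a)) t)"])
    fix p :: "'a \<times> 'a"
    obtain x y where p: "p = (x, y)" by force
    show "tensor_lift mult (tensor_map f (\<lambda>a. unit (counit a)) (frag_of p))
        = f (tensor_lift (\<lambda>x y. frag_cmul (counit y) x) (frag_of p))"
      unfolding p lift_map_of
      by (subst unit_eq) (simp add: mult_frag_cmul unit_right additive_cmul[OF assms])
  qed (intro additive_lift_map additive_compose[OF assms] additive_tensor_lift)+
  then show ?thesis by (simp add: counit_right)
qed

end

text \<open>The rank \<open>deg\<close> drops on the left tensor factor of every term whose right
  factor is not \<open>e\<close>. A left convolution inverse is evaluated on left factors, so this
  is what makes the recursion for it well-founded.\<close>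

locale connected_bialgebra = free_bialgebra mult unit comult counit
  for mult :: "('a \<Rightarrow>\<^sub>0 int) \<Rightarrow> ('a \<Rightarrow>\<^sub>0 int) \<Rightarrow> ('a \<Rightarrow>\<^sub>0 int)"
    and unit :: "int \<Rightarrow> ('a \<Rightarrow>\<^sub>0 int)"
    and comult :: "('a \<Rightarrow>\<^sub>0 int) \<Rightarrow> ('a \<times> 'a \<Rightarrow>\<^sub>0 int)"
    and counit :: "('a \<Rightarrow>\<^sub>0 int) \<Rightarrow> int" +
  fixes e :: 'a and deg :: "'a \<Rightarrow> nat"
  assumes unit_basis: "unit 1 = frag_of e"
    and counit_basis: "\<And>x. x \<noteq> e \<Longrightarrow> counit (frag_of x) = 0"
    and connected: "\<And>x y z. \<lbrakk>(y, z) \<in> Poly_Mapping.keys (comult (frag_of x)); z \<noteq> e\<rbrakk> \<Longrightarrow> deg y < deg x"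
begin

text \<open>The terms of the coproduct of \<open>x\<close> with right factor \<open>e\<close>
  contribute \<open>g x\<close> by the counit law, so the equation for a left inverse can be solved
  for \<open>g x\<close> by recursion on \<open>deg\<close>. The solution is again additive and
  fixes \<open>e\<close>, so the construction can be applied to its own output.\<close>

lemma left_convolution_inverse:
  assumes f: "additive f" "f (frag_of e) = frag_of e"
  obtains g where "additive g" "g (frag_of e) = frag_of e"
    "\<And>a. convolution g f a = unit (counit a)"
proof -
  define R where "R G x = frag_extend (\<lambda>(y, z). if z = e then 0 else mult (G y) (f (frag_of z)))
    (comult (frag_of x))" for G :: "'a \<Rightarrow> 'a \<Rightarrow>\<^sub>0 int" and x
  define F where "F G x = unit (counit (frag_of x)) - R G x" for G :: "'a \<Rightarrow> 'a \<Rightarrow>\<^sub>0 int" and x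
  define G where "G = wfrec (measure deg) F"
  have "adm_wf (measure deg) F"
    unfolding adm_wf_def
  proof (intro allI impI)
    fix G G' :: "'a \<Rightarrow> 'a \<Rightarrow>\<^sub>0 int" and x
    assume eq: "\<forall>z. (z, x) \<in> measure deg \<longrightarrow> G z = G' z"
    have "R G x = R G' x"
      unfolding R_def by (rule frag_extend_eq) (use connected eq in auto)
    then show "F G x = F G' x" by (simp add: F_def)
  qed
  then have "G = F G" unfolding G_def by (rule wfrec_fixpoint[OF wf_measure])
  then have G: "G x = unit (counit (frag_of x)) - R G x" for x
    unfolding F_def by metis
  define g where "g = frag_extend G"
  have g: "additive g" unfolding g_def by (rule additive_frag_extend)
  have g_of: "g (frag_of x) = G x" for x by (simp add: g_def)
  have "comult (frag_of e) = frag_of (e, e)"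
    using comult_unit by (simp add: unit_basis)
  then have e: "g (frag_of e) = frag_of e"
    using counit_unit by (simp add: g_of G R_def unit_basis)
  have "convolution g f (frag_of x) = unit (counit (frag_of x))" for x
  proof -
    \<comment> \<open>The first summand lives on \<open>z = e\<close>, where \<open>f\<close> yields
      the unit; the second lives on \<open>z \<noteq> e\<close>, where the counit vanishes.\<close>
    have "convolution g f (frag_of x) = frag_extend (\<lambda>p.
        g (case p of (y, z) \<Rightarrow> frag_cmul (counit (frag_of z)) (frag_of y))
        + (case p of (y, z) \<Rightarrow> if z = e then 0 else mult (G y) (f (frag_of z)))) (comult (frag_of x))"
      unfolding convolution_eq
    proof (rule frag_extend_eq)
      fix p :: "'a \<times> 'a"
      obtain y z where p: "p = (y, z)" by force
      show "(case p of (x, y) \<Rightarrow> mult (g (frag_of x)) (f (frag_of y))) =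
         g (case p of (y, z) \<Rightarrow> frag_cmul (counit (frag_of z)) (frag_of y)) +
         (case p of (y, z) \<Rightarrow> if z = e then 0 else mult (G y) (f (frag_of z)))"
        using f(2) counit_unit unit_right[of "G y"] additive.zero[OF g] counit_basis[of z]
        by (auto simp: p g_of unit_basis)
    qed
    also have "\<dots> = g (tensor_lift (\<lambda>x y. frag_cmul (counit y) x) (comult (frag_of x))) + R G x"
      by (simp only: frag_extend_fun_add additive_frag_extend_eq[OF g] R_def tensor_lift_def)
    also have "\<dots> = unit (counit (frag_of x))"
      by (simp add: counit_right g_of) (simp add: G)
    finally show ?thesis .
  qed
  then have "convolution g f a = unit (counit a)" for a
    by (rule additive_eqI[OF additive_convolution additive_compose[OF unit_linear counit_linear]])
  with g e show thesis by (rule that)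
qed

text \<open>The left inverse of the identity has itself a left inverse, which must be the identity.\<close>

theorem antipode_exists: "\<exists>S. free_Hopf_algebra mult unit comult counit S"
proof -
  obtain S where S: "additive S" "S (frag_of e) = frag_of e"
    "\<And>a. convolution S id a = unit (counit a)"
    by (rule left_convolution_inverse[of id]) (auto simp: additive_id)
  obtain T where T: "additive T" "\<And>a. convolution T S a = unit (counit a)"
    by (rule left_convolution_inverse[of S]) (use S in auto)
  have "T a = id a" for a
  proof -
    have "T a = convolution T (convolution S id) a"
      using convolution_unit_right[OF T(1), of a] S(3) by (metis ext)
    also have "\<dots> = convolution (convolution T S) id a"
      by (simp add: convolution_assoc[OF T(1) S(1) additive_id(1)])
    also have "\<dots> = id a"
      using convolution_unit_left[OF additive_id(1), of a] T(2) by (metis ext)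
    finally show ?thesis .
  qed
  then have "T = id" by (rule ext)
  then have "free_Hopf_algebra mult unit comult counit S"
    using S T(2) by unfold_locales (simp_all add: convolution_def additive.add)
  then show ?thesis by (rule exI[of _ S])
qed

end

section \<open>Collapsing adjacent repetitions\<close>

text \<open>Together with its mirror image below, this yields associativity of the multiplication
  \<open>remdups_adj (x @ y)\<close> on words without adjacent repetitions.\<close>

lemma remdups_adj_append_right: "remdups_adj (x @ remdups_adj y) = remdups_adj (x @ y)"
  by (induction x) (simp_all add: remdups_adj_Cons distinct_adj_altdef[symmetric])

lemma remdups_adj_append_left: "remdups_adj (remdups_adj x @ y) = remdups_adj (x @ y)"
proof -
  have "remdups_adj (rev (remdups_adj x @ y)) = remdups_adj (rev (x @ y))"
    unfolding rev_append remdups_adj_rev[symmetric] remdups_adj_append_right ..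
  then show ?thesis by (simp only: remdups_adj_rev rev_is_rev_conv)
qed

text \<open>Erasing letters can bring equal letters together, so collapsing is needed after
  \<open>filter\<close> in any case, and collapsing beforehand then changes nothing. This makes the
  projections to part of the alphabet compatible with the multiplication of reduced words.\<close>

lemma remdups_adj_filter: "remdups_adj (filter P (remdups_adj x)) = remdups_adj (filter P x)"
proof (induction x rule: remdups_adj.induct)
  case (3 a b xs)
  show ?case
  proof (cases "a = b")
    case True
    with 3 show ?thesis by auto
  next
    case False
    then have *: "remdups_adj (filter P (remdups_adj (b # xs))) = remdups_adj (filter P (b # xs))"
      by (rule 3)
    then have "remdups_adj ([a] @ filter P (remdups_adj (b # xs))) = remdups_adj ([a] @ filter P (b # xs))"
      by (metis remdups_adj_append_right)
    with * False show ?thesis by simp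
  qed
qed auto

lemma remdups_adj_map_inj_on:
  "inj_on f (set x) \<Longrightarrow> remdups_adj (map f x) = map f (remdups_adj x)"
proof (induction x rule: remdups_adj.induct)
  case (3 a b xs)
  then show ?case by (auto simp: inj_on_eq_iff)
qed auto

text \<open>At most one letter is lost where two reduced words meet. The two cases become the two
  families of terms in the product.\<close>

lemma remdups_adj_append_distinct_adj:
  assumes "distinct_adj x" "distinct_adj y"
  shows "remdups_adj (x @ y) =
    (if x \<noteq> [] \<and> y \<noteq> [] \<and> last x = hd y then x @ tl y else x @ y)"
proof (cases "x \<noteq> [] \<and> y \<noteq> [] \<and> last x = hd y")
  case True
  then obtain x' a y' where x: "x = x' @ [a]" and y: "y = a # y'"
    by (metis append_butlast_last_id list.collapse)
  have "remdups_adj (x @ y) = remdups_adj (x' @ remdups_adj (a # a # y'))"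
    by (simp only: remdups_adj_append_right) (simp add: x y)
  also have "\<dots> = remdups_adj (x @ y')"
    by (simp only: remdups_adj.simps if_True refl remdups_adj_append_right) (simp add: x)
  also have "\<dots> = x @ y'"
    using assms unfolding distinct_adj_altdef[symmetric] x y
    by (auto simp: distinct_adj_append_iff distinct_adj_Cons)
  finally show ?thesis using True y by simp
next
  case False
  then have "distinct_adj (x @ y)"
    using assms by (auto simp: distinct_adj_append_iff)
  then have "remdups_adj (x @ y) = x @ y" by (simp only: distinct_adj_altdef)
  then show ?thesis using False by (simp only: if_False)
qed

section \<open>Set compositions as level sets\<close>

lemma sorted_list_of_set_Un:
  assumes "finite A" "finite B" "\<And>a b. a \<in> A \<Longrightarrow> b \<in> B \<Longrightarrow> a < b"
  shows "sorted_list_of_set (A \<union> B) = sorted_list_of_set A @ sorted_list_of_set B"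
  using assms
  by (intro sorted_distinct_set_unique) (auto simp: sorted_append less_imp_le)

lemma sorted_list_of_set_filter:
  assumes "finite A"
  shows "sorted_list_of_set {x \<in> A. P x} = filter P (sorted_list_of_set A)"
  using assms
  by (intro sorted_distinct_set_unique) (auto intro: sorted_filter[of id, simplified])

lemma sorted_list_of_set_image:
  fixes g :: "'a::linorder \<Rightarrow> 'b::linorder"
  assumes "finite A" "strict_mono_on A g"
  shows "sorted_list_of_set (g ` A) = map g (sorted_list_of_set A)"
proof (rule sorted_distinct_set_unique)
  show "sorted (map g (sorted_list_of_set A))"
    unfolding sorted_wrt_map
    by (rule sorted_wrt_mono_rel[OF _ sorted_sorted_list_of_set[of A]])
      (use assms in \<open>auto dest: strict_mono_onD simp: le_less\<close>)
  show "distinct (map g (sorted_list_of_set A))"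
    using assms by (simp add: distinct_map strict_mono_on_imp_inj_on)
qed (use assms in auto)

text \<open>Only the order of the values of \<open>f\<close> matters, and gaps between them are
  allowed. One \<open>f\<close> therefore describes a set composition together with all its
  restrictions, without renumbering the blocks.\<close>

definition blocks :: "nat set \<Rightarrow> (nat \<Rightarrow> nat) \<Rightarrow> nat set list" where
  "blocks S f = map (\<lambda>l. {i \<in> S. f i = l}) (sorted_list_of_set (f ` S))"

lemma blocks_cong: "(\<And>i. i \<in> S \<Longrightarrow> f i = g i) \<Longrightarrow> blocks S f = blocks S g"
  by (auto simp: blocks_def cong: image_cong)

lemma length_blocks: "length (blocks S f) = card (f ` S)"
  by (simp add: blocks_def)

lemma set_blocks: "finite S \<Longrightarrow> set (blocks S f) = (\<lambda>l. {i \<in> S. f i = l}) ` f ` S"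
  by (simp add: blocks_def)

lemma Union_blocks [simp]: "finite S \<Longrightarrow> \<Union>(set (blocks S f)) = S"
  by (auto simp: set_blocks)

lemma set_composition_blocks:
  assumes "finite S" "0 \<notin> S"
  shows "set_composition S (blocks S f)"
proof -
  have "sorted_wrt disjnt (blocks S f)"
    unfolding blocks_def sorted_wrt_map
    by (rule sorted_wrt_mono_rel[OF _ strict_sorted_list_of_set]) (auto simp: disjnt_def)
  moreover have "{} \<notin> set (blocks S f)"
    using assms by (auto simp: set_blocks)
  ultimately show ?thesis
    using assms by (simp add: set_composition_def)
qed

text \<open>The function \<open>f\<close> sends a letter to the index of its block, which is unique
  by disjointness. No block is empty, so the indices fill an initial segment, and cutting the
  composition amounts to choosing a threshold.\<close>

lemma set_composition_blocksE:
  assumes "set_composition S w"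
  obtains f where "w = blocks S f" "f ` S = {..<length w}"
proof -
  have disj: "j = k" if "j < length w" "k < length w" "i \<in> w ! j" "i \<in> w ! k" for i j k
  proof (rule ccontr)
    have "disjnt (w ! a) (w ! b)" if "a < b" "b < length w" for a b
      using assms that by (simp add: set_composition_def sorted_wrt_iff_nth_less)
    moreover assume "j \<noteq> k"
    ultimately show False
      using that by (cases j k rule: linorder_cases) (auto simp: disjnt_iff)
  qed
  have S: "S = \<Union>(set w)" "finite S" and ne: "{} \<notin> set w"
    using assms by (auto simp: set_composition_def)
  define f where "f i = (SOME j. j < length w \<and> i \<in> w ! j)" for i
  have f: "f i < length w \<and> i \<in> w ! f i" if "i \<in> S" for i
    unfolding f_def by (rule someI_ex) (use that S in \<open>auto simp: in_set_conv_nth\<close>)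
  have lev: "{i \<in> S. f i = j} = w ! j" if "j < length w" for j
    using that f disj S(1) by (fastforce simp: in_set_conv_nth)
  have im: "f ` S = {..<length w}"
  proof
    show "{..<length w} \<subseteq> f ` S"
    proof
      fix j assume "j \<in> {..<length w}"
      then have j: "j < length w" by simp
      with ne have "w ! j \<noteq> {}" using nth_mem by metis
      with lev[OF j] show "j \<in> f ` S" by auto
    qed
  qed (use f in auto)
  have "w = blocks S f"
    by (rule nth_equalityI) (simp_all add: blocks_def im lev lessThan_atLeast0)
  with im show thesis by (rule that[rotated])
qed

lemma M_perms_blocks_iff:
  assumes "finite S" "0 \<notin> S"
  shows "blocks S f \<in> M_perms n \<longleftrightarrow> S = {1..n} \<and> (\<forall>i. i \<in> S \<longrightarrow> Suc i \<in> S \<longrightarrow> f i \<noteq> f (Suc i))"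
proof -
  have "set_composition {1..n} (blocks S f) \<longleftrightarrow> S = {1..n}"
    using set_composition_blocks[OF assms] Union_blocks[OF assms(1)]
    by (metis set_composition_def)
  then show ?thesis
    using assms by (auto simp: M_perms_def set_blocks)
qed

text \<open>Intersecting with \<open>T\<close> empties precisely the levels that \<open>f\<close>
  does not take on \<open>S \<inter> T\<close>, so the same \<open>f\<close> serves after the
  restriction.\<close>

lemma restriction_blocks:
  assumes "finite S"
  shows "restriction (blocks S f) T = blocks (S \<inter> T) f"
proof -
  have "f ` (S \<inter> T) = {l \<in> f ` S. {i \<in> S. f i = l} \<inter> T \<noteq> {}}"
    by (auto, metis IntI image_eqI)
  then have "sorted_list_of_set (f ` (S \<inter> T))
      = filter (\<lambda>l. {i \<in> S. f i = l} \<inter> T \<noteq> {}) (sorted_list_of_set (f ` S))"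
    using assms by (simp only: sorted_list_of_set_filter finite_imageI)
  moreover have "{i \<in> S. f i = l} \<inter> T = {i \<in> S \<inter> T. f i = l}" for l by auto
  ultimately show ?thesis
    by (simp add: restriction_def blocks_def filter_map comp_def)
qed

text \<open>As the values of \<open>f\<close> fill an interval, cuts correspond one to one to
  thresholds \<open>j\<close>. For empty \<open>S\<close> the hypotheses force \<open>a = b\<close>,
  and the single threshold gives the single factorization of the empty composition.\<close>

lemma blocks_split:
  assumes "finite S" "f ` S = {a..<b}" "a \<le> b"
  defines "h \<equiv> \<lambda>j. (blocks {i \<in> S. f i < j} f, blocks {i \<in> S. j \<le> f i} f)"
  shows "{(u, v). u @ v = blocks S f} = h ` {a..b}" "inj_on h {a..b}"
proof -
  have *: "h j = (map (\<lambda>l. {i \<in> S. f i = l}) [a..<j], map (\<lambda>l. {i \<in> S. f i = l}) [j..<b])"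
    if "j \<in> {a..b}" for j
  proof -
    have im: "f ` {i \<in> S. f i < j} = {a..<j}" "f ` {i \<in> S. j \<le> f i} = {j..<b}"
    proof -
      have "f ` {i \<in> S. f i < j} = f ` S \<inter> {..<j}" "f ` {i \<in> S. j \<le> f i} = f ` S \<inter> {j..}"
        by auto
      then show "f ` {i \<in> S. f i < j} = {a..<j}" "f ` {i \<in> S. j \<le> f i} = {j..<b}"
        using that by (auto simp: assms(2))
    qed
    show ?thesis
      unfolding h_def blocks_def im by (auto intro!: arg_cong[where f = "\<lambda>x. map x _"])
  qed
  have bl: "blocks S f = map (\<lambda>l. {i \<in> S. f i = l}) [a..<b]"
    by (simp add: blocks_def assms(2))
  show "{(u, v). u @ v = blocks S f} = h ` {a..b}"
  proof (intro set_eqI iffI)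
    fix p assume "p \<in> {(u, v). u @ v = blocks S f}"
    then obtain u v where p: "p = (u, v)" and uv: "u @ v = blocks S f" by auto
    have len: "length u \<le> b - a"
      using arg_cong[OF uv, of length] by (simp add: bl)
    have "u = take (length u) (blocks S f)" "v = drop (length u) (blocks S f)"
      by (simp_all flip: uv)
    with len have "p = h (a + length u)"
      using assms(3) by (subst *) (auto simp: p bl take_map drop_map take_upt drop_upt)
    then show "p \<in> h ` {a..b}" using len assms(3) by auto
  next
    fix p assume "p \<in> h ` {a..b}"
    then obtain j where j: "j \<in> {a..b}" "p = h j" by auto
    then have "[a..<b] = [a..<j] @ [j..<b]"
      by (metis atLeastAtMost_iff le_iff_add upt_add_eq_append)
    with j show "p \<in> {(u, v). u @ v = blocks S f}"
      by (simp add: * bl flip: map_append)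
  qed
  show "inj_on h {a..b}"
  proof (rule inj_onI)
    fix j k assume jk: "j \<in> {a..b}" "k \<in> {a..b}" "h j = h k"
    then have "length (fst (h j)) = length (fst (h k))" by simp
    then have "j - a = k - a" by (simp only: *[OF jk(1)] *[OF jk(2)] fst_conv length_map length_upt)
    with jk show "j = k" by auto
  qed
qed

section \<open>Standardization of words\<close>

text \<open>The letters of a set composition start at 1 and list positions at 0, hence
  \<open>i - 1\<close>.\<close>

definition word_blocks :: "nat list \<Rightarrow> nat set list" where
  "word_blocks x = blocks {1..length x} (\<lambda>i. x ! (i - 1))"

text \<open>Standardization as a single collapse, with no rewriting; \<open>st_blocks\<close>
  identifies it with \<open>st\<close>. Collapsing first puts the argument of
  \<open>mperm_of\<close> into the range of \<open>word_of\<close>.\<close>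

definition std :: "nat list \<Rightarrow> mperm" where
  "std x = mperm_of (word_blocks (remdups_adj x))"

lemma map_nth_pred: "map (\<lambda>i. x ! (i - 1)) (sorted_list_of_set {1..length x}) = x"
proof -
  have "sorted_list_of_set {1..length x} = [1..<Suc (length x)]"
    unfolding atLeastLessThanSuc_atLeastAtMost[symmetric] by (rule sorted_list_of_set_range)
  then show ?thesis by (auto intro!: nth_equalityI simp del: upt_Suc)
qed

lemma word_blocks_map: "word_blocks (map f [1..<Suc n]) = blocks {1..n} f"
  unfolding word_blocks_def by (auto intro!: blocks_cong simp del: upt_Suc)

lemma word_blocks_M_perms: "distinct_adj x \<Longrightarrow> word_blocks x \<in> M_perms (length x)"
  unfolding word_blocks_def
  by (auto simp: M_perms_blocks_iff distinct_adj_conv_nth Suc_le_eq dest: gr0_implies_Suc)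

lemma M_perms_word:
  assumes "finite S" "0 \<notin> S" "blocks S f \<in> M_perms n"
  shows "blocks S f = word_blocks (remdups_adj (map f (sorted_list_of_set S)))"
    "distinct_adj (map f (sorted_list_of_set S))" "S = {1..n}"
proof -
  have S: "S = {1..n}" and f: "\<And>i. i \<in> S \<Longrightarrow> Suc i \<in> S \<Longrightarrow> f i \<noteq> f (Suc i)"
    using assms by (auto simp: M_perms_blocks_iff)
  have l: "sorted_list_of_set S = [1..<Suc n]"
    unfolding S atLeastLessThanSuc_atLeastAtMost[symmetric] by (rule sorted_list_of_set_range)
  show d: "distinct_adj (map f (sorted_list_of_set S))"
    unfolding l distinct_adj_conv_nth using f by (auto simp: S simp del: upt_Suc)
  then have "remdups_adj (map f (sorted_list_of_set S)) = map f (sorted_list_of_set S)"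
    by (simp add: distinct_adj_altdef)
  then show "blocks S f = word_blocks (remdups_adj (map f (sorted_list_of_set S)))"
    by (simp only: l word_blocks_map) (simp add: S)
qed (use assms in \<open>simp add: M_perms_blocks_iff\<close>)

lemma word_of_std: "word_of (std x) = word_blocks (remdups_adj x)"
  unfolding std_def
  by (rule mperm_of_inverse) (use word_blocks_M_perms[of "remdups_adj x"] in auto)

lemma std_eq_iff: "std x = std y \<longleftrightarrow> word_blocks (remdups_adj x) = word_blocks (remdups_adj y)"
  by (metis word_of_std word_of_inject)

lemma std_remdups_adj [simp]: "std (remdups_adj x) = std x"
  using distinct_adj_remdups_adj[of x] by (simp add: std_eq_iff distinct_adj_altdef)

lemma Union_word_blocks [simp]: "\<Union>(set (word_blocks x)) = {1..length x}"
  by (simp add: word_blocks_def)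

lemma mdeg_std: "mdeg (std x) = length (remdups_adj x)"
  by (simp add: mdeg_def word_of_std)

lemma mdeg_std_distinct_adj: "distinct_adj x \<Longrightarrow> mdeg (std x) = length x"
  by (simp add: mdeg_std distinct_adj_altdef)

text \<open>The representative is read off from block indices, so its alphabet is an initial
  segment; this lets the coproduct be indexed by thresholds.\<close>

lemma std_surj:
  obtains x where "distinct_adj x" "std x = w" "set x = {0..<length (word_of w)}"
proof -
  obtain n where n: "word_of w \<in> M_perms n" using word_of[of w] by blast
  then have "set_composition {1..n} (word_of w)" by (simp add: M_perms_def)
  then obtain f where f: "word_of w = blocks {1..n} f" "f ` {1..n} = {..<length (word_of w)}"
    by (rule set_composition_blocksE)
  define x where "x = map f (sorted_list_of_set {1..n})"
  have "word_of w = word_blocks (remdups_adj x)" "distinct_adj x"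
    using M_perms_word[of "{1..n}" f n] n f(1) by (auto simp: x_def)
  then have "std x = w" by (metis word_of_std word_of_inject)
  moreover have "set x = {0..<length (word_of w)}" using f(2) by (auto simp: x_def)
  ultimately show thesis using \<open>distinct_adj x\<close> that by blast
qed

section \<open>Invariance and termination of the standardization rules\<close>

lemma blocks_image_index:
  assumes "finite S" "strict_mono_on S g" "\<And>i. i \<in> S \<Longrightarrow> f' (g i) = f i"
  shows "blocks (g ` S) f' = map ((`) g) (blocks S f)"
    "map f' (sorted_list_of_set (g ` S)) = map f (sorted_list_of_set S)"
proof -
  have im: "f' ` g ` S = f ` S" using assms(3) by force
  have "{i \<in> g ` S. f' i = l} = g ` {i \<in> S. f i = l}" for l using assms(3) by auto
  then show "blocks (g ` S) f' = map ((`) g) (blocks S f)"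
    by (simp add: blocks_def im)
  show "map f' (sorted_list_of_set (g ` S)) = map f (sorted_list_of_set S)"
    unfolding sorted_list_of_set_image[OF assms(1,2)] using assms(1,3) by simp
qed

lemma blocks_R1:
  assumes "finite S" "i \<in> S" "Suc i \<in> S" "f i = f (Suc i)"
  shows "map (\<lambda>C. C - {Suc i}) (blocks S f) = blocks (S - {Suc i}) f"
    "remdups_adj (map f (sorted_list_of_set (S - {Suc i}))) = remdups_adj (map f (sorted_list_of_set S))"
proof -
  have im: "f ` (S - {Suc i}) = f ` S"
  proof (intro equalityI subsetI)
    fix l assume "l \<in> f ` S"
    then obtain j where "j \<in> S" "l = f j" by blast
    then have "l = f (if j = Suc i then i else j)" "(if j = Suc i then i else j) \<in> S - {Suc i}"
      using assms by auto
    then show "l \<in> f ` (S - {Suc i})" by (rule image_eqI)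
  qed auto
  have "{j \<in> S. f j = l} - {Suc i} = {j \<in> S - {Suc i}. f j = l}" for l by auto
  then show "map (\<lambda>C. C - {Suc i}) (blocks S f) = blocks (S - {Suc i}) f"
    by (simp add: blocks_def im)
  define A B where "A = {j \<in> S. j < i}" and "B = {j \<in> S. Suc i < j}"
  have fin: "finite A" "finite B" using assms(1) by (auto simp: A_def B_def)
  \<comment> \<open>In the increasing list of letters, \<open>i\<close> and \<open>Suc i\<close> are
    neighbours between \<open>A\<close> and \<open>B\<close>, so dropping \<open>Suc i\<close>
    removes one of two adjacent equal levels.\<close>
  have S: "S = A \<union> ({i} \<union> ({Suc i} \<union> B))" "S - {Suc i} = A \<union> ({i} \<union> B)"
    using assms(2,3) by (auto simp: A_def B_def)
  have 1: "sorted_list_of_set ({k} \<union> B) = sorted_list_of_set {k} @ sorted_list_of_set B" if "k \<le> Suc i" for k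
    by (rule sorted_list_of_set_Un) (use that fin in \<open>auto simp: B_def\<close>)
  have 2: "sorted_list_of_set ({i} \<union> ({Suc i} \<union> B)) = sorted_list_of_set {i} @ sorted_list_of_set ({Suc i} \<union> B)"
    by (rule sorted_list_of_set_Un) (use fin in \<open>auto simp: B_def\<close>)
  have 3: "sorted_list_of_set (A \<union> C) = sorted_list_of_set A @ sorted_list_of_set C"
    if "finite C" "\<And>c. c \<in> C \<Longrightarrow> i \<le> c" for C
    by (rule sorted_list_of_set_Un) (use that fin in \<open>force simp: A_def\<close>)+
  have "sorted_list_of_set S = sorted_list_of_set A @ sorted_list_of_set ({i} \<union> ({Suc i} \<union> B))"
    by (subst S(1), rule 3) (use fin in \<open>auto simp: B_def\<close>)
  then have l1: "sorted_list_of_set S = sorted_list_of_set A @ i # Suc i # sorted_list_of_set B"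
    by (simp only: 2 1[OF order_refl]) simp
  have "sorted_list_of_set (S - {Suc i}) = sorted_list_of_set A @ sorted_list_of_set ({i} \<union> B)"
    by (subst S(2), rule 3) (use fin in \<open>auto simp: B_def\<close>)
  then have l2: "sorted_list_of_set (S - {Suc i}) = sorted_list_of_set A @ i # sorted_list_of_set B"
    using 1[of i] by simp
  show "remdups_adj (map f (sorted_list_of_set (S - {Suc i}))) = remdups_adj (map f (sorted_list_of_set S))"
    unfolding l1 l2 using remdups_adj_append_right[of "map f (sorted_list_of_set A)" "f i # f i # map f (sorted_list_of_set B)"]
      remdups_adj_append_right[of "map f (sorted_list_of_set A)" "f i # map f (sorted_list_of_set B)"]
    by (simp add: assms(4))
qed

text \<open>Since \<open>i\<close> is missing from \<open>S\<close>, the map \<open>g\<close> does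
  not merge \<open>i\<close> with \<open>i + 1\<close> and is strictly increasing on
  \<open>S\<close>. The function \<open>f'\<close> is \<open>f\<close> after undoing the shift, so
  the word of levels is literally unchanged.\<close>

lemma blocks_R2:
  fixes i :: nat and f :: "nat \<Rightarrow> nat"
  assumes "finite S" "0 < i" "i \<notin> S"
  defines "g \<equiv> \<lambda>x. if i < x then x - 1 else x"
    and "f' \<equiv> \<lambda>x. if x < i then f x else f (x + 1)"
  shows "map ((`) g) (blocks S f) = blocks (g ` S) f'"
    "map f' (sorted_list_of_set (g ` S)) = map f (sorted_list_of_set S)"
    "strict_mono_on S g"
proof -
  show g: "strict_mono_on S g"
  proof (rule strict_mono_onI)
    fix x y assume "x \<in> S" "y \<in> S" "x < y"
    moreover from this have "x \<noteq> i" "y \<noteq> i" using assms(3) by auto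
    ultimately show "g x < g y" by (auto simp: g_def)
  qed
  have "f' (g j) = f j" if "j \<in> S" for j
  proof -
    have "j \<noteq> i" using that assms(3) by auto
    then show ?thesis using assms(2) by (auto simp: f'_def g_def)
  qed
  note * = blocks_image_index[where f = f and f' = f', OF assms(1) g this]
  show "map ((`) g) (blocks S f) = blocks (g ` S) f'" by (rule *(1)[symmetric])
  show "map f' (sorted_list_of_set (g ` S)) = map f (sorted_list_of_set S)" by (rule *(2))
qed

text \<open>R1 removes an adjacent repetition from the word of levels and R2 leaves that word alone,
  so the collapsed word is an invariant of the rewriting.\<close>

lemma st_step_blocks:
  assumes "finite S" "0 \<notin> S" "st_step (blocks S f) w"
  obtains S' f' where "finite S'" "0 \<notin> S'" "w = blocks S' f'"
    "remdups_adj (map f' (sorted_list_of_set S')) = remdups_adj (map f (sorted_list_of_set S))"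
  using assms(3)
proof cases
  case (R1 B i)
  then have "i \<in> S" "Suc i \<in> S" "f i = f (Suc i)" using assms(1) by (auto simp: set_blocks)
  note * = blocks_R1[OF assms(1) this]
  show thesis
    by (rule that[of "S - {Suc i}" f]) (use assms R1 * in auto)
next
  case (R2 i)
  then have i: "0 < i" "i \<notin> S" using assms(1) by auto
  note * = blocks_R2(1,2)[OF assms(1) i, of f]
  show thesis
    by (rule that[OF _ _ _ arg_cong[OF *(2), of remdups_adj]])
      (use assms i R2 *(1) in \<open>auto split: if_splits\<close>)
qed

lemma st_steps_blocks:
  assumes "st_step\<^sup>*\<^sup>* (blocks S f) w" "finite S" "0 \<notin> S"
  obtains S' f' where "finite S'" "0 \<notin> S'" "w = blocks S' f'"
    "remdups_adj (map f' (sorted_list_of_set S')) = remdups_adj (map f (sorted_list_of_set S))"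
proof -
  have "\<exists>S' f'. finite S' \<and> 0 \<notin> S' \<and> w = blocks S' f' \<and>
    remdups_adj (map f' (sorted_list_of_set S')) = remdups_adj (map f (sorted_list_of_set S))"
    using assms(1)
  proof (induction rule: rtranclp_induct)
    case base
    show ?case using assms by blast
  next
    case (step v w)
    then obtain S' f' where *: "finite S'" "0 \<notin> S'" "v = blocks S' f'"
      "remdups_adj (map f' (sorted_list_of_set S')) = remdups_adj (map f (sorted_list_of_set S))"
      by blast
    with step(2) have "st_step (blocks S' f') w" by simp
    then show ?case
      by (rule st_step_blocks[OF *(1,2)]) (use *(4) in metis)
  qed
  then show thesis using that by blast
qed

text \<open>The sum of the letters is a termination measure: R1 deletes a positive letter, and R2
  lowers some letter as soon as the gap lies below one.\<close>

lemma st_steps_M_perms: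
  assumes "finite S" "0 \<notin> S"
  shows "\<exists>n. \<exists>v\<in>M_perms n. st_step\<^sup>*\<^sup>* (blocks S f) v"
  using assms
proof (induction "\<Sum>S" arbitrary: S f rule: less_induct)
  case (less S f)
  note fin = less.prems(1)
  consider "blocks S f \<in> M_perms (card S)"
    | i where "i \<in> S" "Suc i \<in> S" "f i = f (Suc i)"
    | "S \<noteq> {1..card S}"
    using M_perms_blocks_iff[OF less.prems] by blast
  then show ?case
  proof cases
    case 1
    then show ?thesis by blast
  next
    case (2 i)
    then have "st_step (blocks S f) (blocks (S - {Suc i}) f)"
      using st_step.R1[of "{j \<in> S. f j = f i}" "blocks S f" i] fin
      by (auto simp: blocks_R1(1)[OF fin 2] set_blocks)
    moreover have "\<Sum>(S - {Suc i}) < \<Sum>S"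
      using fin 2 by (simp add: sum.remove[of S "Suc i"])
    then have "\<exists>n. \<exists>v\<in>M_perms n. st_step\<^sup>*\<^sup>* (blocks (S - {Suc i}) f) v"
      by (rule less.hyps) (use less.prems in auto)
    ultimately show ?thesis by (meson converse_rtranclp_into_rtranclp)
  next
    case 3
    \<comment> \<open>R2 at an \<open>i\<close> above all letters changes nothing, so a gap with a
      letter \<open>x\<close> beyond it has to be found; without one, \<open>S\<close> would be an
      initial segment.\<close>
    have "\<exists>i x. 0 < i \<and> i \<notin> S \<and> x \<in> S \<and> i < x"
    proof (rule ccontr)
      assume no: "\<nexists>i x. 0 < i \<and> i \<notin> S \<and> x \<in> S \<and> i < x"
      have "S = {1..Max (insert 0 S)}"
      proof (intro set_eqI iffI)
        fix x assume "x \<in> S"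
        then show "x \<in> {1..Max (insert 0 S)}"
          using less.prems by (cases x) auto
      next
        fix x assume x: "x \<in> {1..Max (insert 0 S)}"
        then have "Max (insert 0 S) \<noteq> 0" by auto
        then have "Max (insert 0 S) \<in> S" using Max_in[of "insert 0 S"] fin by auto
        with x no show "x \<in> S" by (metis Suc_le_eq atLeastAtMost_iff le_neq_implies_less One_nat_def)
      qed
      then have "S = {1..card S}" by (metis card_atLeastAtMost diff_Suc_1)
      with 3 show False ..
    qed
    then obtain i x where i: "0 < i" "i \<notin> S" and x: "x \<in> S" "i < x" by blast
    define g where "g = (\<lambda>x. if i < x then x - 1 else x)"
    note R2 = blocks_R2[OF fin i, folded g_def]
    have inj: "inj_on g S" by (rule strict_mono_on_imp_inj_on[OF R2(3)])
    have "st_step (blocks S f) (map ((`) g) (blocks S f))"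
      unfolding g_def using st_step.R2[of i "blocks S f"] i fin by simp
    then have step: "st_step (blocks S f) (blocks (g ` S) (\<lambda>x. if x < i then f x else f (x + 1)))"
      by (simp only: R2(1))
    have "\<Sum>(g ` S) = (\<Sum>x\<in>S. g x)" using sum.reindex[OF inj, of "\<lambda>x. x"] by simp
    also have "\<dots> < (\<Sum>x\<in>S. x)"
      using x by (intro sum_strict_mono_ex1 fin) (auto simp: g_def intro!: bexI[of _ x])
    finally have "\<exists>n. \<exists>v\<in>M_perms n. st_step\<^sup>*\<^sup>* (blocks (g ` S) (\<lambda>x. if x < i then f x else f (x + 1))) v"
      by (rule less.hyps) (use less.prems i in \<open>auto simp: g_def split: if_splits\<close>)
    with step show ?thesis by (meson converse_rtranclp_into_rtranclp)
  qed
qed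

text \<open>In the definite description, existence comes from termination and uniqueness from the
  invariant: an \<MM>-permutation is determined by its collapsed word, so all reachable ones
  coincide.\<close>

lemma st_blocks:
  assumes "finite S" "0 \<notin> S"
  shows "st (blocks S f) = std (map f (sorted_list_of_set S))"
proof -
  have reach: "v = word_of (std (map f (sorted_list_of_set S)))"
    if v: "st_step\<^sup>*\<^sup>* (blocks S f) v" "v \<in> M_perms n" for v n
  proof -
    obtain S' f' where *: "finite S'" "0 \<notin> S'" "v = blocks S' f'"
      "remdups_adj (map f' (sorted_list_of_set S')) = remdups_adj (map f (sorted_list_of_set S))"
      using st_steps_blocks[OF v(1) assms] by blast
    show ?thesis
      using M_perms_word(1)[OF *(1,2), of f' n] v(2) *(3,4) by (simp add: word_of_std)
  qed
  show ?thesis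
    unfolding st_def
  proof (rule the_equality)
    show "st_step\<^sup>*\<^sup>* (blocks S f) (word_of (std (map f (sorted_list_of_set S))))"
      using st_steps_M_perms[OF assms] reach by metis
    fix p assume "st_step\<^sup>*\<^sup>* (blocks S f) (word_of p)"
    moreover obtain n where "word_of p \<in> M_perms n" using word_of[of p] by blast
    ultimately show "p = std (map f (sorted_list_of_set S))"
      using reach word_of_inject by blast
  qed
qed

section \<open>Restrictions, renamings and cuts of words\<close>

lemma restriction_word_blocks: "restriction (word_blocks x) {1..m} = word_blocks (take m x)"
proof -
  have "{1..length x} \<inter> {1..m} = {1..length (take m x)}" by auto
  then show ?thesis
    unfolding word_blocks_def restriction_blocks[OF finite_atLeastAtMost]
    by (simp only:) (rule blocks_cong, auto)
qed

lemma st_restriction_word_blocks: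
  "st (restriction (word_blocks x) {Suc m..length x}) = std (drop m x)"
proof -
  have eq: "{1..length x} \<inter> {Suc m..length x} = {Suc m..<Suc (length x)}" by auto
  have "st (restriction (word_blocks x) {Suc m..length x})
      = std (map (\<lambda>i. x ! (i - 1)) [Suc m..<Suc (length x)])"
    unfolding word_blocks_def restriction_blocks[OF finite_atLeastAtMost] eq
    by (simp add: st_blocks del: upt_Suc)
  also have "map (\<lambda>i. x ! (i - 1)) [Suc m..<Suc (length x)] = drop m x"
    by (rule nth_equalityI) (auto simp del: upt_Suc)
  finally show ?thesis .
qed

lemma std_map:
  assumes "strict_mono_on (set x) g"
  shows "std (map g x) = std x"
proof -
  have *: "word_blocks (map g y) = word_blocks y" if g: "strict_mono_on (set y) g" for y
  proof -
    let ?f = "\<lambda>i. y ! (i - 1)"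
    have set: "?f ` {1..length y} = set y"
      by (subst (3) map_nth_pred[symmetric]) simp
    have inj: "inj_on g (set y)" by (rule strict_mono_on_imp_inj_on[OF g])
    have "blocks {1..length y} (\<lambda>i. g (?f i)) = blocks {1..length y} ?f"
    proof -
      have im: "(\<lambda>i. g (?f i)) ` {1..length y} = g ` set y"
        unfolding set[symmetric] image_image ..
      have "{i \<in> {1..length y}. g (?f i) = g l} = {i \<in> {1..length y}. ?f i = l}" if "l \<in> set y" for l
        using that inj set by (auto simp: inj_on_eq_iff)
      then show ?thesis
        unfolding blocks_def im set by (simp add: sorted_list_of_set_image[OF _ g])
    qed
    moreover have "word_blocks (map g y) = blocks {1..length y} (\<lambda>i. g (?f i))"
      unfolding word_blocks_def length_map by (rule blocks_cong) auto
    ultimately show ?thesis by (simp only: word_blocks_def)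
  qed
  have "remdups_adj (map g x) = map g (remdups_adj x)"
    by (rule remdups_adj_map_inj_on[OF strict_mono_on_imp_inj_on[OF assms]])
  then show ?thesis using assms *[of "remdups_adj x"] by (simp add: std_eq_iff)
qed

text \<open>Blocks are listed by increasing level, so comparisons between the letters of
  \<open>x\<close> can be recovered from the blocks alone. The list position \<open>i\<close>
  appears there as the letter \<open>Suc i\<close>.\<close>

lemma word_blocks_less_iff:
  assumes "i < length x" "j < length x"
  shows "x ! i < x ! j \<longleftrightarrow> (\<exists>a b. a < b \<and> b < length (word_blocks x) \<and>
    Suc i \<in> word_blocks x ! a \<and> Suc j \<in> word_blocks x ! b)"
proof -
  let ?f = "\<lambda>i. x ! (i - 1)"
  define L where "L = sorted_list_of_set (?f ` {1..length x})"
  have wb: "word_blocks x = map (\<lambda>l. {i \<in> {1..length x}. ?f i = l}) L"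
    by (simp add: word_blocks_def blocks_def L_def)
  have L: "sorted_wrt (<) L" unfolding L_def by simp
  have setL: "set L = ?f ` {1..length x}" unfolding L_def by simp
  have mem: "Suc k \<in> word_blocks x ! a \<longleftrightarrow> x ! k = L ! a" if "k < length x" "a < length L" for k a
    using that by (simp add: wb)
  have ex: "\<exists>a<length L. x ! k = L ! a" if "k < length x" for k
  proof -
    have "?f (Suc k) \<in> set L" unfolding setL using that by (intro imageI) auto
    then show ?thesis by (auto simp: in_set_conv_nth)
  qed
  show ?thesis
  proof
    assume less: "x ! i < x ! j"
    obtain a b where ab: "a < length L" "x ! i = L ! a" "b < length L" "x ! j = L ! b"
      using ex[OF assms(1)] ex[OF assms(2)] by blast
    have "a < b"
    proof (rule ccontr)
      assume "\<not> a < b"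
      then have "L ! b \<le> L ! a"
        using L ab by (metis le_less linorder_neqE_nat sorted_wrt_nth_less)
      with less ab show False by simp
    qed
    moreover have "b < length (word_blocks x)" using ab by (simp add: wb)
    moreover have "Suc i \<in> word_blocks x ! a" "Suc j \<in> word_blocks x ! b"
      using mem[OF assms(1) ab(1)] mem[OF assms(2) ab(3)] ab by simp_all
    ultimately show "\<exists>a b. a < b \<and> b < length (word_blocks x) \<and>
      Suc i \<in> word_blocks x ! a \<and> Suc j \<in> word_blocks x ! b" by blast
  next
    assume "\<exists>a b. a < b \<and> b < length (word_blocks x) \<and>
      Suc i \<in> word_blocks x ! a \<and> Suc j \<in> word_blocks x ! b"
    then obtain a b where ab: "a < b" "b < length L" "x ! i = L ! a" "x ! j = L ! b"
      using mem assms by (auto simp: wb)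
    then show "x ! i < x ! j" using L by (simp add: sorted_wrt_iff_nth_less)
  qed
qed

text \<open>Converse of \<open>std_map\<close> for reduced words: equal blocks mean equal
  comparisons between positions, and the positionwise correspondence of letters is then an
  increasing map.\<close>

lemma std_eqE:
  assumes "distinct_adj x" "distinct_adj y" "std x = std y"
  obtains g where "strict_mono_on (set x) g" "y = map g x"
proof -
  have wb: "word_blocks x = word_blocks y"
    using assms by (simp add: std_eq_iff distinct_adj_altdef)
  then have "{1..length x} = {1..length y}" by (metis Union_word_blocks)
  then have len: "length x = length y" by (metis card_atLeastAtMost diff_Suc_1)
  have less: "x ! i < x ! j \<longleftrightarrow> y ! i < y ! j" if "i < length x" "j < length x" for i j
    using that by (simp add: word_blocks_less_iff wb len)
  \<comment> \<open>Any occurrence of \<open>l\<close> in \<open>x\<close> may be chosen: at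
    positions with equal letters in \<open>x\<close>, neither letter of \<open>y\<close> is smaller
    than the other.\<close>
  define g where "g l = y ! (SOME i. i < length x \<and> x ! i = l)" for l
  have g: "g (x ! i) = y ! i" if "i < length x" for i
  proof -
    define k where "k = (SOME k. k < length x \<and> x ! k = x ! i)"
    have "k < length x \<and> x ! k = x ! i"
      unfolding k_def by (rule someI) (use that in simp)
    then have "y ! k = y ! i" using less[of k i] less[of i k] that by simp
    then show ?thesis by (simp add: g_def k_def)
  qed
  have "strict_mono_on (set x) g"
    by (rule strict_mono_onI) (use g less in \<open>auto simp: in_set_conv_nth\<close>)
  moreover have "y = map g x" by (rule nth_equalityI) (simp_all add: len g)
  ultimately show thesis by (rule that)
qed

text \<open>Stated for words with repetitions over any interval, because iterating the coproduct
  applies it to filtered words: filtering creates repetitions, and the upper part has an alphabet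
  starting at the threshold.\<close>

lemma basis_comult_std:
  assumes "set x = {a..<b}" "a \<le> b"
  shows "basis_comult (std x)
    = (\<Sum>j\<in>{a..b}. frag_of (std (filter (\<lambda>l. l < j) x), std (filter (\<lambda>l. j \<le> l) x)))"
proof -
  define y where "y = remdups_adj x"
  let ?S = "{1..length y}" and ?f = "\<lambda>i. y ! (i - 1)"
  have y: "map ?f (sorted_list_of_set ?S) = y" by (rule map_nth_pred)
  have im: "?f ` ?S = {a..<b}"
    using arg_cong[OF y, of set] assms(1) by (simp add: y_def)
  have filt: "std (filter P y) = std (filter P x)" for P
    by (metis remdups_adj_filter std_remdups_adj y_def)
  have "basis_comult (std x) = (\<Sum>(u, v)\<in>{(u, v). u @ v = blocks ?S ?f}. frag_of (st u, st v))"
    by (simp add: basis_comult_def word_of_std word_blocks_def y_def)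
  also have "\<dots> = (\<Sum>j\<in>{a..b}. frag_of (st (blocks {i \<in> ?S. ?f i < j} ?f), st (blocks {i \<in> ?S. j \<le> ?f i} ?f)))"
    unfolding blocks_split(1)[OF finite_atLeastAtMost im assms(2)]
    by (subst sum.reindex[OF blocks_split(2)[OF finite_atLeastAtMost im assms(2)]]) (simp add: comp_def)
  also have "\<dots> = (\<Sum>j\<in>{a..b}. frag_of (std (filter (\<lambda>l. l < j) y), std (filter (\<lambda>l. j \<le> l) y)))"
  proof (rule sum.cong[OF refl])
    fix j
    have "st (blocks {i \<in> ?S. P (?f i)} ?f) = std (filter P y)" for P
    proof -
      have "st (blocks {i \<in> ?S. P (?f i)} ?f) = std (filter P (map ?f (sorted_list_of_set ?S)))"
        unfolding filter_map comp_def sorted_list_of_set_filter[OF finite_atLeastAtMost, symmetric]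
        by (rule st_blocks) auto
      then show ?thesis by (simp only: y)
    qed
    from this[of "\<lambda>l. l < j"] this[of "\<lambda>l. j \<le> l"] show "frag_of (st (blocks {i \<in> ?S. ?f i < j} ?f), st (blocks {i \<in> ?S. j \<le> ?f i} ?f))
       = frag_of (std (filter (\<lambda>l. l < j) y), std (filter (\<lambda>l. j \<le> l) y))"
      by (simp only:)
  qed
  finally show ?thesis by (simp only: filt)
qed

lemma length_word_of_std: "length (word_of (std x)) = card (set x)"
proof -
  have "set (remdups_adj x) = (\<lambda>i. remdups_adj x ! (i - 1)) ` {1..length (remdups_adj x)}"
    using arg_cong[OF map_nth_pred[of "remdups_adj x"], of set] by (simp del: remdups_adj_set)
  then show ?thesis by (simp add: word_of_std word_blocks_def length_blocks)
qed

lemma std_eq_Nil_iff: "std x = std [] \<longleftrightarrow> x = []"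
proof
  assume "std x = std []"
  then have "length (remdups_adj x) = 0" by (metis list.size(3) mdeg_std remdups_adj.simps(1))
  then show "x = []" by simp
qed simp

lemma mperm_of_Nil: "mperm_of [] = std []"
  by (simp add: std_def word_blocks_def blocks_def)

text \<open>Shifting \<open>q\<close> past the alphabet of \<open>p\<close> separates the two tensor
  factors, so that comparison with \<open>k\<close> tells to which factor a letter of a combined
  word belongs.\<close>

lemma std_pair_surj:
  obtains p q k where "distinct_adj p" "distinct_adj q" "std p = P" "std q = Q"
    "\<And>l. l \<in> set p \<Longrightarrow> l < k" "\<And>l. l \<in> set q \<Longrightarrow> k \<le> (l::nat)"
proof -
  obtain p where p: "distinct_adj p" "std p = P" "set p = {0..<length (word_of P)}"
    by (rule std_surj)
  obtain q where q: "distinct_adj q" "std q = Q"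
    by (rule std_surj)
  define k where "k = length (word_of P)"
  have mono: "strict_mono_on (set q) (\<lambda>l. l + k)" by (rule strict_mono_onI) simp
  have "distinct_adj (map (\<lambda>l. l + k) q)" using q by (intro distinct_adj_mapI) auto
  moreover have "std (map (\<lambda>l. l + k) q) = Q" using std_map[OF mono] q by simp
  ultimately show thesis
    using p by (intro that[of p "map (\<lambda>l. l + k) q" k]) (auto simp: k_def)
qed

section \<open>The product\<close>

text \<open>A factorization \<open>(x, y)\<close> where \<open>x\<close> ends with the first letter of \<open>y\<close> corresponds to the
  second family of terms in \<open>w \<bullet> u\<close>, every other one to the first family.\<close>

definition factorizations :: "nat list \<Rightarrow> (nat list \<times> nat list) set" where
  "factorizations v = {(x, y). distinct_adj x \<and> distinct_adj y \<and> remdups_adj (x @ y) = v}"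

lemma factorizations_length:
  assumes "(x, y) \<in> factorizations v"
  shows "length x \<le> length v" "length y \<le> length v" "length v \<le> length x + length y"
proof -
  have "v = (if x \<noteq> [] \<and> y \<noteq> [] \<and> last x = hd y then x @ tl y else x @ y)"
    using assms unfolding factorizations_def
    by (metis (mono_tags, lifting) case_prodD mem_Collect_eq remdups_adj_append_distinct_adj)
  then show "length x \<le> length v" "length y \<le> length v" "length v \<le> length x + length y"
    by (cases x; cases y; simp split: if_splits)+
qed

lemma factorizations_set: "(x, y) \<in> factorizations v \<Longrightarrow> set v = set x \<union> set y"
  unfolding factorizations_def by (metis (mono_tags) case_prodD mem_Collect_eq remdups_adj_set set_append)

lemma finite_factorizations: "finite (factorizations v)"
proof (rule finite_subset)
  show "factorizations v \<subseteq> {x. set x \<subseteq> set v \<and> length x \<le> length v}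
      \<times> {y. set y \<subseteq> set v \<and> length y \<le> length v}"
    using factorizations_length factorizations_set by fastforce
qed (simp add: finite_lists_length_le)

lemma factorizations_Nil: "factorizations [] = {([], [])}"
  by (auto simp: factorizations_def)

lemma word_blocks_M_perms_iff: "distinct_adj x \<Longrightarrow> word_blocks x \<in> M_perms n \<longleftrightarrow> length x = n"
proof
  assume "word_blocks x \<in> M_perms n"
  then have "{1..length x} = {1..n}"
    by (metis (mono_tags, lifting) M_perms_def Union_word_blocks mem_Collect_eq set_composition_def)
  then show "length x = n" by (metis card_atLeastAtMost diff_Suc_1)
qed (use word_blocks_M_perms in auto)

lemma distinct_adj_take: "distinct_adj x \<Longrightarrow> distinct_adj (take n x)"
  and distinct_adj_drop: "distinct_adj x \<Longrightarrow> distinct_adj (drop n x)"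
  by (auto simp: distinct_adj_conv_nth)

lemma word_of_std_distinct_adj: "distinct_adj x \<Longrightarrow> word_of (std x) = word_blocks x"
  by (simp add: word_of_std distinct_adj_altdef)

text \<open>Disjoint nonempty blocks are distinct, and there are finitely many lists of distinct
  subsets of \<open>{1..n}\<close>.\<close>

lemma finite_M_perms: "finite {v. word_of v \<in> M_perms n}"
proof -
  have dist: "sorted_wrt disjnt w \<Longrightarrow> {} \<notin> set w \<Longrightarrow> distinct w" for w :: "nat set list"
    by (induction w) (auto simp: disjnt_def)
  have "M_perms n \<subseteq> {w. set w \<subseteq> Pow {1..n} \<and> distinct w}"
    using dist by (auto simp: M_perms_def set_composition_def)
  moreover have "finite {w. set w \<subseteq> Pow {1..n} \<and> distinct w}"
    by (rule finite_subset_distinct) simp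
  ultimately have "finite (M_perms n)" by (rule finite_subset)
  then have "finite (word_of -` M_perms n)"
    by (rule finite_vimageI) (simp add: inj_def word_of_inject)
  then show ?thesis by (simp add: vimage_def)
qed

lemma prod_terms1_std:
  assumes "distinct_adj v" "mdeg w = m" "mdeg u = n"
  shows "std v \<in> prod_terms1 w u
    \<longleftrightarrow> length v = m + n \<and> std (take m v) = w \<and> std (drop m v) = u"
proof -
  have "restriction (word_blocks v) {1..m} = word_of w \<longleftrightarrow> std (take m v) = w"
    using assms distinct_adj_take[of v m]
    by (metis restriction_word_blocks word_of_std_distinct_adj word_of_inject)
  moreover have "st (restriction (word_blocks v) {m+1..m+n}) = std (drop m v)" if "length v = m + n"
    using st_restriction_word_blocks[of v m] that by simp
  ultimately show ?thesis
    using assms by (auto simp: prod_terms1_def word_of_std_distinct_adj word_blocks_M_perms_iff)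
qed

lemma prod_terms2_std:
  assumes "distinct_adj v" "mdeg w = m" "mdeg u = n"
  shows "std v \<in> prod_terms2 w u \<longleftrightarrow> 0 < m \<and> 0 < n \<and> length v = m + n - 1
    \<and> std (take m v) = w \<and> std (drop (m - 1) v) = u"
proof -
  have 1: "restriction (word_blocks v) {1..m} = word_of w \<longleftrightarrow> std (take m v) = w"
    using assms distinct_adj_take[of v m]
    by (metis restriction_word_blocks word_of_std_distinct_adj word_of_inject)
  have 2: "st (restriction (word_blocks v) {m..m+n-1}) = std (drop (m - 1) v)"
    if len: "length v = m + n - 1"
  proof -
    \<comment> \<open>For \<open>m = 0\<close>, truncated subtraction gives
      \<open>Suc (m - 1) = 1\<close> while the interval on the left starts at 0; intersecting with
      \<open>{1..length v}\<close> removes the difference.\<close>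
    have "{1..length v} \<inter> {m..m+n-1} = {1..length v} \<inter> {Suc (m - 1)..length v}"
      using len by auto
    then have "restriction (word_blocks v) {m..m+n-1} = restriction (word_blocks v) {Suc (m - 1)..length v}"
      by (simp only: word_blocks_def restriction_blocks[OF finite_atLeastAtMost])
    then show ?thesis by (simp only: st_restriction_word_blocks)
  qed
  \<comment> \<open>Together with \<open>length v = m + n - 1\<close>, the two length equations
    exclude \<open>m = 0\<close> and \<open>n = 0\<close>: a shared letter needs two nonempty
    factors.\<close>
  have 3: "length (take m v) = m" if "std (take m v) = w"
    using assms that mdeg_std_distinct_adj[OF distinct_adj_take[OF assms(1)]] by metis
  have 4: "length (drop (m - 1) v) = n" if "std (drop (m - 1) v) = u"
    using assms that mdeg_std_distinct_adj[OF distinct_adj_drop[OF assms(1)]] by metis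
  show ?thesis
    unfolding prod_terms2_def assms(2,3) Let_def mem_Collect_eq
      word_of_std_distinct_adj[OF assms(1)] word_blocks_M_perms_iff[OF assms(1)] 1
    using 2 3 4 by auto
qed

text \<open>The degrees of \<open>w\<close> and \<open>u\<close> fix the lengths of the two factors,
  so \<open>v\<close> has at most one such factorization without and one with a shared letter at the
  seam.\<close>

lemma factorizations_prod_terms:
  assumes v: "distinct_adj v" and m: "mdeg w = m" and n: "mdeg u = n"
  shows "{(x, y) \<in> factorizations v. std x = w \<and> std y = u}
    = (if std v \<in> prod_terms1 w u then {(take m v, drop m v)} else {})
    \<union> (if std v \<in> prod_terms2 w u then {(take m v, drop (m - 1) v)} else {})" (is "?L = ?R")
proof
  show "?L \<subseteq> ?R"
  proof
    fix p assume "p \<in> ?L"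
    then obtain x y where p: "p = (x, y)" "(x, y) \<in> factorizations v"
      and w: "w = std x" and u: "u = std y" by auto
    then have xy: "distinct_adj x" "distinct_adj y" "remdups_adj (x @ y) = v"
      using p by (auto simp: factorizations_def)
    have len: "length x = m" "length y = n"
      using m n xy w u by (auto simp: mdeg_std_distinct_adj)
    note rd = remdups_adj_append_distinct_adj[OF xy(1,2), unfolded xy(3)]
    show "p \<in> ?R"
    proof (cases "x \<noteq> [] \<and> y \<noteq> [] \<and> last x = hd y")
      case True
      then have v': "v = x @ tl y" using rd by simp
      have "drop (m - 1) v = last x # tl y"
        using True len v' by (cases x rule: rev_cases) auto
      then have "drop (m - 1) v = y" "take m v = x"
        using True len v' by auto
      then have "std v \<in> prod_terms2 w u"
        using True len v' w u by (subst prod_terms2_std[OF v m n], cases y) auto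
      with \<open>drop (m - 1) v = y\<close> \<open>take m v = x\<close> show ?thesis by (auto simp: p(1))
    next
      case False
      then have "v = x @ y" using rd by (simp only: if_False)
      then have "take m v = x" "drop m v = y" "length v = m + n" using len by auto
      moreover from this have "std v \<in> prod_terms1 w u"
        using w u by (subst prod_terms1_std[OF v m n]) auto
      ultimately show ?thesis by (auto simp: p(1))
    qed
  qed
next
  have "(take m v, drop m v) \<in> ?L" if "std v \<in> prod_terms1 w u"
    using that v unfolding prod_terms1_std[OF v m n]
    by (auto simp: factorizations_def distinct_adj_take distinct_adj_drop) (simp add: distinct_adj_altdef)
  moreover have "(take m v, drop (m - 1) v) \<in> ?L" if t2: "std v \<in> prod_terms2 w u"
  proof -
    from t2 have t: "0 < m" "0 < n" "length v = m + n - 1" "std (take m v) = w" "std (drop (m - 1) v) = u"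
      unfolding prod_terms2_std[OF v m n] by auto
    have ne: "take m v \<noteq> []" "drop (m - 1) v \<noteq> []" and len: "length (take m v) = m"
      using t by auto
    moreover have "last (take m v) = hd (drop (m - 1) v)"
      unfolding last_conv_nth[OF ne(1)] len using t by (simp add: hd_drop_conv_nth)
    moreover have "tl (drop (m - 1) v) = drop m v"
      using t by (metis drop_Suc tl_drop Suc_diff_1)
    ultimately have "remdups_adj (take m v @ drop (m - 1) v) = v"
      by (subst remdups_adj_append_distinct_adj) (auto simp: v distinct_adj_take distinct_adj_drop)
    with t show ?thesis by (auto simp: factorizations_def v distinct_adj_take distinct_adj_drop)
  qed
  ultimately show "?R \<subseteq> ?L" by auto
qed

lemma int_card_filter: "finite A \<Longrightarrow> int (card {x \<in> A. P x}) = (\<Sum>x\<in>A. if P x then 1 else 0)"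
  by (simp add: sum.inter_filter[symmetric])

lemma lookup_sum_frag_of:
  assumes "finite A"
  shows "Poly_Mapping.lookup (\<Sum>x\<in>A. frag_of (f x)) z = int (card {x \<in> A. f x = z})"
  using assms
  by (auto simp: lookup_sum int_card_filter lookup_single when_def intro!: sum.cong)

lemma lookup_basis_mult:
  assumes v: "distinct_adj v"
  shows "Poly_Mapping.lookup (basis_mult w u) (std v)
    = int (card {(x, y) \<in> factorizations v. std x = w \<and> std y = u})"
proof -
  have fin: "finite (prod_terms1 w u)" "finite (prod_terms2 w u)"
    unfolding prod_terms1_def prod_terms2_def Let_def
    by (rule finite_subset[OF _ finite_M_perms[of "mdeg w + mdeg u"]], blast)
      (rule finite_subset[OF _ finite_M_perms[of "mdeg w + mdeg u - 1"]], blast)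
  have single: "{x \<in> A. x = std v} = (if std v \<in> A then {std v} else {})" for A by auto
  \<comment> \<open>The two candidate factorizations must differ; otherwise they would count once in
    the union but twice in the product.\<close>
  have "drop (mdeg w) v \<noteq> drop (mdeg w - 1) v"
    if "std v \<in> prod_terms2 w u"
  proof
    assume "drop (mdeg w) v = drop (mdeg w - 1) v"
    then have "length v - mdeg w = length v - (mdeg w - 1)" by (metis length_drop)
    with that show False unfolding prod_terms2_std[OF v refl refl] by linarith
  qed
  then show ?thesis
    unfolding factorizations_prod_terms[OF v refl refl] basis_mult_def lookup_add
    by (auto simp: lookup_sum_frag_of[OF fin(1), of "\<lambda>x. x"] lookup_sum_frag_of[OF fin(2), of "\<lambda>x. x"] single)
qed

section \<open>Bilinear extension and the algebra axioms\<close>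

lemma additive_MMR_mult: "additive (\<lambda>a. MMR_mult a b)" "additive (\<lambda>b. MMR_mult a b)"
proof -
  show "additive (\<lambda>a. MMR_mult a b)"
    unfolding MMR_mult_def by (rule additive_frag_extend)
  show "additive (\<lambda>b. MMR_mult a b)"
    unfolding MMR_mult_def by (rule additive_frag_extend_fun) (rule additive_frag_extend)
qed

lemma MMR_mult_of [simp]: "MMR_mult (frag_of w) (frag_of u) = basis_mult w u"
  by (simp add: MMR_mult_def)

lemma bilinear_eqI:
  fixes f g :: "('a \<Rightarrow>\<^sub>0 int) \<Rightarrow> ('b \<Rightarrow>\<^sub>0 int) \<Rightarrow> 'c::ab_group_add"
  assumes "\<And>b. additive (\<lambda>a. f a b)" "\<And>a. additive (\<lambda>b. f a b)"
    and "\<And>b. additive (\<lambda>a. g a b)" "\<And>a. additive (\<lambda>b. g a b)"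
    and "\<And>x y. f (frag_of x) (frag_of y) = g (frag_of x) (frag_of y)"
  shows "f a b = g a b"
proof (rule additive_eqI[OF assms(1,3)])
  fix x
  show "f (frag_of x) b = g (frag_of x) b"
    by (rule additive_eqI[OF assms(2,4)]) (rule assms(5))
qed

lemma lookup_MMR_mult:
  assumes v: "distinct_adj v"
  shows "Poly_Mapping.lookup (MMR_mult a b) (std v)
    = (\<Sum>(x, y)\<in>factorizations v. Poly_Mapping.lookup a (std x) * Poly_Mapping.lookup b (std y))"
proof (rule bilinear_eqI[where f = "\<lambda>a b. Poly_Mapping.lookup (MMR_mult a b) (std v)"])
  show "additive (\<lambda>a. \<Sum>(x, y)\<in>factorizations v. Poly_Mapping.lookup a (std x) * Poly_Mapping.lookup b (std y))"
    for b :: MMR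
    unfolding split_beta by (rule additive_sum additive_mult_right additive_lookup)+
  show "additive (\<lambda>b. \<Sum>(x, y)\<in>factorizations v. Poly_Mapping.lookup a (std x) * Poly_Mapping.lookup b (std y))"
    for a :: MMR
    unfolding split_beta by (rule additive_sum additive_mult_left additive_lookup)+
  fix w u
  have "Poly_Mapping.lookup (basis_mult w u) (std v)
      = int (card {p \<in> factorizations v. std (fst p) = w \<and> std (snd p) = u})"
    unfolding lookup_basis_mult[OF v] by (rule arg_cong[where f = "\<lambda>A. int (card A)"]) auto
  also have "\<dots> = (\<Sum>p\<in>factorizations v. Poly_Mapping.lookup (frag_of w) (std (fst p))
      * Poly_Mapping.lookup (frag_of u) (std (snd p)))"
    unfolding int_card_filter[OF finite_factorizations]
    by (rule sum.cong) (auto simp: lookup_single when_def)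
  finally show "Poly_Mapping.lookup (MMR_mult (frag_of w) (frag_of u)) (std v)
    = (\<Sum>(x, y)\<in>factorizations v. Poly_Mapping.lookup (frag_of w) (std x) * Poly_Mapping.lookup (frag_of u) (std y))"
    by (simp add: split_beta)
qed (rule additive_compose[OF additive_lookup] additive_MMR_mult)+

lemma MMR_eqI:
  assumes "\<And>v. distinct_adj v \<Longrightarrow> Poly_Mapping.lookup a (std v) = Poly_Mapping.lookup b (std v)"
  shows "a = b"
  by (rule poly_mapping_eqI) (metis assms std_surj)

lemma MMR_mult_assoc: "MMR_mult (MMR_mult a b) c = MMR_mult a (MMR_mult b c)"
proof (rule MMR_eqI)
  fix v :: "nat list" assume v: "distinct_adj v"
  let ?l = "\<lambda>a x. Poly_Mapping.lookup a (std x)"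
  have d: "distinct_adj x" "distinct_adj y" if "(x, y) \<in> factorizations u" for x y u
    using that by (auto simp: factorizations_def)
  have "?l (MMR_mult (MMR_mult a b) c) v = (\<Sum>p\<in>factorizations v. (\<Sum>q\<in>factorizations (fst p).
      ?l a (fst q) * ?l b (snd q) * ?l c (snd p)))"
    unfolding lookup_MMR_mult[OF v] split_beta
    by (rule sum.cong[OF refl]) (auto simp: lookup_MMR_mult d sum_distrib_right split_beta)
  also have "\<dots> = (\<Sum>(p, q)\<in>(SIGMA p:factorizations v. factorizations (fst p)).
      ?l a (fst q) * ?l b (snd q) * ?l c (snd p))"
    by (rule sum.Sigma) (simp_all add: finite_factorizations)
  \<comment> \<open>Both index sets parametrize triples of reduced words with product
    \<open>v\<close>. Regrouping forgets one intermediate product and forms the other.\<close>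
  also have "\<dots> = (\<Sum>(p, q)\<in>(SIGMA p:factorizations v. factorizations (snd p)).
      ?l a (fst p) * (?l b (fst q) * ?l c (snd q)))"
    by (rule sum.reindex_bij_witness[of _
          "\<lambda>((x, y), (x', y')). ((remdups_adj (x @ x'), y'), (x, x'))"
          "\<lambda>((x, y), (x', y')). ((x', remdups_adj (y' @ y)), (y', y))"])
      (auto simp: factorizations_def remdups_adj_append_left remdups_adj_append_right)
  also have "\<dots> = (\<Sum>p\<in>factorizations v. (\<Sum>q\<in>factorizations (snd p).
      ?l a (fst p) * (?l b (fst q) * ?l c (snd q))))"
    by (rule sum.Sigma[symmetric]) (simp_all add: finite_factorizations)
  also have "\<dots> = ?l (MMR_mult a (MMR_mult b c)) v"
    unfolding lookup_MMR_mult[OF v] split_beta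
    by (rule sum.cong[OF refl]) (auto simp: lookup_MMR_mult d sum_distrib_left split_beta)
  finally show "?l (MMR_mult (MMR_mult a b) c) v = ?l (MMR_mult a (MMR_mult b c)) v" .
qed

lemma MMR_unit_1: "MMR_unit 1 = frag_of (std [])"
  by (simp add: MMR_unit_def mperm_of_Nil)

lemma MMR_mult_unit: "MMR_mult (MMR_unit 1) a = a" "MMR_mult a (MMR_unit 1) = a"
proof -
  let ?l = "\<lambda>a x. Poly_Mapping.lookup a (std x)"
  have one: "?l (MMR_unit 1) x = (if x = [] then 1 else 0)" for x
    unfolding MMR_unit_1 by (auto simp: lookup_single when_def std_eq_Nil_iff eq_commute[of "std []"])
  show "MMR_mult (MMR_unit 1) a = a"
  proof (rule MMR_eqI)
    fix v :: "nat list" assume v: "distinct_adj v"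
    \<comment> \<open>A nonempty left factor has coefficient zero in the unit, and
      \<open>([], v)\<close> is the only factorization with an empty one.\<close>
    have "?l (MMR_mult (MMR_unit 1) a) v = (\<Sum>(x, y)\<in>{([], v)}. ?l (MMR_unit 1) x * ?l a y)"
      unfolding lookup_MMR_mult[OF v]
      using v by (intro sum.mono_neutral_right finite_factorizations)
        (auto simp: factorizations_def one distinct_adj_altdef split: if_splits)
    then show "?l (MMR_mult (MMR_unit 1) a) v = ?l a v" by (simp add: one)
  qed
  show "MMR_mult a (MMR_unit 1) = a"
  proof (rule MMR_eqI)
    fix v :: "nat list" assume v: "distinct_adj v"
    have "?l (MMR_mult a (MMR_unit 1)) v = (\<Sum>(x, y)\<in>{(v, [])}. ?l a x * ?l (MMR_unit 1) y)"
      unfolding lookup_MMR_mult[OF v]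
      using v by (intro sum.mono_neutral_right finite_factorizations)
        (auto simp: factorizations_def one distinct_adj_altdef split: if_splits)
    then show "?l (MMR_mult a (MMR_unit 1)) v = ?l a v" by (simp add: one)
  qed
qed

section \<open>The coproduct\<close>

text \<open>The projections onto the letters below \<open>k\<close> and onto the remaining letters are monoid
  homomorphisms, which is why the coproduct is multiplicative.\<close>

definition shuffles_of :: "nat \<Rightarrow> nat list \<Rightarrow> nat list \<Rightarrow> nat list set" where
  "shuffles_of k p q = {v. distinct_adj v \<and> remdups_adj (filter (\<lambda>l. l < k) v) = p
    \<and> remdups_adj (filter (\<lambda>l. k \<le> l) v) = q}"

lemma shuffles_of_set:
  assumes "v \<in> shuffles_of k p q"
  shows "set v = set p \<union> set q"
proof -
  have "set p = {l \<in> set v. l < k}" "set q = {l \<in> set v. k \<le> l}"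
    using assms by (auto simp: shuffles_of_def)
  then show ?thesis by auto
qed

lemma strict_mono_on_surj_id:
  fixes g :: "'a::linorder \<Rightarrow> 'a"
  assumes "finite A" "strict_mono_on A g" "g ` A = A" "a \<in> A"
  shows "g a = a"
proof -
  have "map g (sorted_list_of_set A) = map id (sorted_list_of_set A)"
    using sorted_list_of_set_image[OF assms(1,2)] assms(3) by simp
  then have "\<forall>a\<in>set (sorted_list_of_set A). g a = id a" by (simp only: map_eq_conv)
  then show ?thesis using assms(1,4) by simp
qed

text \<open>Both words use exactly the letters of \<open>p\<close> and \<open>q\<close>, so the
  renaming between them is an increasing map of this alphabet onto itself, which is the
  identity.\<close>

lemma shuffles_of_std_unique:
  assumes "v \<in> shuffles_of k p q" "v' \<in> shuffles_of k p q" "std v = std v'"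
  shows "v = v'"
proof -
  have "distinct_adj v" "distinct_adj v'" using assms by (auto simp: shuffles_of_def)
  then obtain g where g: "strict_mono_on (set v) g" "v' = map g v"
    using assms(3) by (rule std_eqE)
  have "g ` set v = set v"
    using shuffles_of_set[OF assms(1)] shuffles_of_set[OF assms(2)] g(2) by simp
  then have "map g v = v"
    by (intro map_idI strict_mono_on_surj_id[OF _ g(1)]) auto
  with g(2) show ?thesis by simp
qed

text \<open>Serves to compare cuts of a basis element with words projecting to given ones; both are
  unique when they exist.\<close>

lemma card_eq_subsingleton:
  assumes "\<And>x y. x \<in> A \<Longrightarrow> y \<in> A \<Longrightarrow> x = y" "\<And>x y. x \<in> B \<Longrightarrow> y \<in> B \<Longrightarrow> x = y"
    and "A = {} \<longleftrightarrow> B = {}"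
  shows "card A = card B"
proof (cases "A = {}")
  case True
  then show ?thesis using assms(3) by simp
next
  case False
  then obtain a b where "a \<in> A" "b \<in> B" using assms(3) by blast
  then have "A = {a}" "B = {b}" using assms(1,2) by blast+
  then show ?thesis by simp
qed

text \<open>The coefficient is 0 or 1. A contributing cut \<open>j\<close> equals the number of
  blocks of the left part, so it is unique; the word \<open>v\<close> is unique by rigidity of the
  alphabet; and each of the two produces the other.\<close>

lemma lookup_basis_comult:
  assumes p: "distinct_adj p" "\<And>l. l \<in> set p \<Longrightarrow> l < k"
    and q: "distinct_adj q" "\<And>l. l \<in> set q \<Longrightarrow> k \<le> l"
  shows "Poly_Mapping.lookup (basis_comult w) (std p, std q)
    = int (card {v \<in> shuffles_of k p q. std v = w})"
proof -
  define K where "K = length (word_of w)"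
  obtain x where x: "distinct_adj x" "std x = w" "set x = {0..<K}"
    unfolding K_def by (rule std_surj)
  define lo hi where "lo j = filter (\<lambda>l. l < j) x" and "hi j = filter (\<lambda>l. j \<le> l) x" for j
  define J where "J = {j \<in> {0..K}. (std (lo j), std (hi j)) = (std p, std q)}"
  have "Poly_Mapping.lookup (basis_comult w) (std p, std q) = int (card J)"
    unfolding J_def lo_def hi_def x(2)[symmetric] basis_comult_std[OF x(3) le0]
    by (rule lookup_sum_frag_of) simp
  also have "card J = card {v \<in> shuffles_of k p q. std v = w}"
  proof (rule card_eq_subsingleton)
    fix i j assume ij: "i \<in> J" "j \<in> J"
    then have "length (word_of (std (lo i))) = length (word_of (std (lo j)))"
      by (simp add: J_def)
    moreover have "set (lo a) = {0..<a}" if "a \<in> J" for a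
      using that x(3) by (auto simp: J_def lo_def)
    ultimately show "i = j" using ij by (simp add: length_word_of_std)
  next
    fix v v' assume "v \<in> {v \<in> shuffles_of k p q. std v = w}" "v' \<in> {v \<in> shuffles_of k p q. std v = w}"
    then show "v = v'" using shuffles_of_std_unique[of v k p q v'] by simp
  next
    have "\<exists>v. v \<in> shuffles_of k p q \<and> std v = w" if j: "j \<in> J" for j
    proof -
      have std: "std (remdups_adj (lo j)) = std p" "std (remdups_adj (hi j)) = std q" "j \<le> K"
        using j by (simp_all add: J_def)
      obtain g1 where g1: "strict_mono_on (set (remdups_adj (lo j))) g1" "p = map g1 (remdups_adj (lo j))"
        using std_eqE[OF distinct_adj_remdups_adj p(1) std(1)] by blast
      obtain g2 where g2: "strict_mono_on (set (remdups_adj (hi j))) g2" "q = map g2 (remdups_adj (hi j))"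
        using std_eqE[OF distinct_adj_remdups_adj q(1) std(2)] by blast
      have lt: "g1 l < k" if "l \<in> set x" "l < j" for l
        using p(2)[of "g1 l"] that by (simp add: g1(2) lo_def)
      have ge: "k \<le> g2 l" if "l \<in> set x" "j \<le> l" for l
        using q(2)[of "g2 l"] that by (simp add: g2(2) hi_def)
      \<comment> \<open>The glued renaming is increasing because \<open>g1\<close> takes values
        below \<open>k\<close> and \<open>g2\<close> values from \<open>k\<close> on. The image of
        \<open>x\<close> under it is the required word.\<close>
      define g where "g l = (if l < j then g1 l else g2 l)" for l
      have g: "strict_mono_on (set x) g"
      proof (rule strict_mono_onI)
        fix a b assume ab: "a \<in> set x" "b \<in> set x" "a < b"
        consider "b < j" | "a < j" "j \<le> b" | "j \<le> a" by linarith
        then show "g a < g b"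
        proof cases
          case 1
          then have "g1 a < g1 b"
            using strict_mono_onD[OF g1(1), of a b] ab by (simp add: lo_def)
          then show ?thesis using 1 ab by (simp add: g_def)
        next
          case 2
          then have "g1 a < k" "k \<le> g2 b" using lt ge ab by auto
          then show ?thesis using 2 by (simp add: g_def)
        next
          case 3
          then have "g2 a < g2 b"
            using strict_mono_onD[OF g2(1), of a b] ab by (simp add: hi_def)
          then show ?thesis using 3 ab by (simp add: g_def)
        qed
      qed
      note inj = strict_mono_on_imp_inj_on[OF g]
      have less: "g l < k \<longleftrightarrow> l < j" if "l \<in> set x" for l
        using lt[OF that] ge[OF that] by (auto simp: g_def)
      have "filter (\<lambda>l. l < k) (map g x) = map g (lo j)" "filter (\<lambda>l. k \<le> l) (map g x) = map g (hi j)"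
        unfolding filter_map lo_def hi_def using less
        by (auto intro!: arg_cong[where f = "map g"] filter_cong simp: not_less[symmetric])
      moreover have "remdups_adj (map g (lo j)) = map g (remdups_adj (lo j))"
        "remdups_adj (map g (hi j)) = map g (remdups_adj (hi j))"
        using inj by (auto intro!: remdups_adj_map_inj_on simp: lo_def hi_def elim!: inj_on_subset)
      moreover have "map g (remdups_adj (lo j)) = p" "map g (remdups_adj (hi j)) = q"
        unfolding g1(2) g2(2) by (auto simp: g_def lo_def hi_def)
      ultimately have "map g x \<in> shuffles_of k p q"
        using distinct_adj_mapI[OF x(1) inj] by (simp add: shuffles_of_def)
      moreover have "std (map g x) = w" using std_map[OF g] x(2) by simp
      ultimately show ?thesis by blast
    qed
    moreover have "\<exists>j. j \<in> J" if v: "v \<in> shuffles_of k p q" "std v = w" for v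
    proof -
      have "distinct_adj v" "std x = std v" using v x(2) by (auto simp: shuffles_of_def)
      then obtain g where g: "strict_mono_on (set x) g" "v = map g x"
        using std_eqE[OF x(1)] by blast
      \<comment> \<open>The cut lies just before the first level that \<open>g\<close> moves to
        \<open>k\<close> or beyond; if there is none, it is \<open>K\<close>.\<close>
      define j where "j = (LEAST l. K \<le> l \<or> k \<le> g l)"
      have "j \<le> K" unfolding j_def by (rule Least_le) simp
      have j: "K \<le> j \<or> k \<le> g j" unfolding j_def by (rule LeastI[of _ K]) simp
      have less: "l < j \<longleftrightarrow> g l < k" if l: "l \<in> set x" for l
      proof
        assume "l < j"
        then have "\<not> (K \<le> l \<or> k \<le> g l)" unfolding j_def by (rule not_less_Least)
        then show "g l < k" by simp
      next
        assume gl: "g l < k"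
        show "l < j"
        proof (rule ccontr)
          assume "\<not> l < j"
          then have "j \<in> set x" "j \<le> l" using l x(3) by auto
          then have "k \<le> g j" using j x(3) by auto
          moreover have "g j \<le> g l"
            using strict_mono_onD[OF g(1) \<open>j \<in> set x\<close> l] \<open>j \<le> l\<close> by (cases "j = l") auto
          ultimately show False using gl by simp
        qed
      qed
      have map: "map g (lo j) = filter (\<lambda>l. l < k) v" "map g (hi j) = filter (\<lambda>l. k \<le> l) v"
        unfolding g(2) filter_map lo_def hi_def using less
        by (auto intro!: arg_cong[where f = "map g"] filter_cong simp: not_less[symmetric])
      have mono: "strict_mono_on (set (lo j)) g" "strict_mono_on (set (hi j)) g"
        using g(1) by (auto simp: lo_def hi_def strict_mono_on_def)
      have pq: "remdups_adj (filter (\<lambda>l. l < k) v) = p" "remdups_adj (filter (\<lambda>l. k \<le> l) v) = q"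
        using v(1) by (simp_all add: shuffles_of_def)
      have "std (lo j) = std p" "std (hi j) = std q"
        unfolding pq[symmetric] std_remdups_adj map[symmetric] std_map[OF mono(1)] std_map[OF mono(2)]
        by (rule refl)+
      then have "j \<in> J" using \<open>j \<le> K\<close> by (simp add: J_def)
      then show ?thesis ..
    qed
    ultimately show "J = {} \<longleftrightarrow> {v \<in> shuffles_of k p q. std v = w} = {}" by blast
  qed
  finally show ?thesis .
qed

lemma additive_MMR_comult: "additive MMR_comult"
  unfolding MMR_comult_def by (rule additive_frag_extend)

lemma MMR_comult_of [simp]: "MMR_comult (frag_of w) = basis_comult w"
  by (simp add: MMR_comult_def)

text \<open>The length bound matters: for \<open>p = [0]\<close>, \<open>q = [1]\<close> and
  \<open>k = 1\<close>, all alternating words in 0 and 1 of length at least 2 lie in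
  \<open>shuffles_of k p q\<close>.\<close>

lemma finite_shuffles_of: "finite {v \<in> shuffles_of k p q. length v \<le> N}"
  by (rule finite_subset[OF _ finite_lists_length_le[of "set p \<union> set q" N]])
    (use shuffles_of_set in auto)

text \<open>Words longer than \<open>N\<close> have coefficient zero in \<open>a\<close>, so the
  truncated sum stands for the sum over all words projecting to \<open>p\<close> and
  \<open>q\<close>.\<close>

lemma lookup_MMR_comult:
  assumes p: "distinct_adj p" "\<And>l. l \<in> set p \<Longrightarrow> l < k"
    and q: "distinct_adj q" "\<And>l. l \<in> set q \<Longrightarrow> k \<le> l"
    and a: "Poly_Mapping.keys a \<subseteq> {w. mdeg w \<le> N}"
  shows "Poly_Mapping.lookup (MMR_comult a) (std p, std q)
    = (\<Sum>v\<in>{v \<in> shuffles_of k p q. length v \<le> N}. Poly_Mapping.lookup a (std v))"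
  using a
proof (induction a rule: frag_induction)
  case zero
  show ?case using additive.zero[OF additive_MMR_comult] by simp
next
  case (one w)
  have "{v \<in> shuffles_of k p q. std v = w} = {v \<in> {v \<in> shuffles_of k p q. length v \<le> N}. std v = w}"
    using one mdeg_std_distinct_adj by (auto simp: shuffles_of_def)
  then have "Poly_Mapping.lookup (MMR_comult (frag_of w)) (std p, std q)
      = int (card {v \<in> {v \<in> shuffles_of k p q. length v \<le> N}. std v = w})"
    using lookup_basis_comult[OF p q, of w] by simp
  also have "\<dots> = (\<Sum>v\<in>{v \<in> shuffles_of k p q. length v \<le> N}. Poly_Mapping.lookup (frag_of w) (std v))"
    unfolding int_card_filter[OF finite_shuffles_of]
    by (rule sum.cong) (auto simp: lookup_single when_def)
  finally show ?case .
next
  case (diff a b)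
  then show ?case
    by (simp add: additive.diff[OF additive_MMR_comult] lookup_minus sum_subtractf)
qed

lemma lookup_tensor_mult:
  assumes p: "distinct_adj p" and q: "distinct_adj q"
  shows "Poly_Mapping.lookup (tensor_mult MMR_mult s t) (std p, std q)
    = (\<Sum>((p1, p2), (q1, q2))\<in>factorizations p \<times> factorizations q.
        Poly_Mapping.lookup s (std p1, std q1) * Poly_Mapping.lookup t (std p2, std q2))"
  (is "_ = ?R s t")
proof (rule bilinear_eqI[where f = "\<lambda>s t. Poly_Mapping.lookup (tensor_mult MMR_mult s t) (std p, std q)"])
  show "additive (\<lambda>s. ?R s t)" for t
    unfolding split_beta by (rule additive_sum additive_mult_right additive_lookup)+
  show "additive (\<lambda>t. ?R s t)" for s
    unfolding split_beta by (rule additive_sum additive_mult_left additive_lookup)+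
  fix a b :: "mperm \<times> mperm"
  obtain w w' where a: "a = (w, w')" by force
  obtain u u' where b: "b = (u, u')" by force
  let ?l = "\<lambda>w x. Poly_Mapping.lookup (frag_of w) (std x)"
  have "Poly_Mapping.lookup (tensor_mult MMR_mult (frag_of a) (frag_of b)) (std p, std q)
      = (\<Sum>x\<in>factorizations p. ?l w (fst x) * ?l u (snd x))
      * (\<Sum>y\<in>factorizations q. ?l w' (fst y) * ?l u' (snd y))"
    unfolding a b tensor_mult_of lookup_tensor lookup_MMR_mult[OF p] lookup_MMR_mult[OF q] split_beta ..
  also have "\<dots> = (\<Sum>(x, y)\<in>factorizations p \<times> factorizations q.
      (?l w (fst x) * ?l u (snd x)) * (?l w' (fst y) * ?l u' (snd y)))"
    unfolding sum_product sum.cartesian_product ..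
  also have "\<dots> = ?R (frag_of a) (frag_of b)"
    by (rule sum.cong) (auto simp: a b lookup_single when_def)
  finally show "Poly_Mapping.lookup (tensor_mult MMR_mult (frag_of a) (frag_of b)) (std p, std q)
      = ?R (frag_of a) (frag_of b)" .
qed (rule additive_compose[OF additive_lookup] additive_tensor_mult)+

text \<open>Provides the length bound with which the coproduct of a product is expanded.\<close>

lemma keys_basis_mult: "Poly_Mapping.keys (basis_mult w u) \<subseteq> {z. mdeg z \<le> mdeg w + mdeg u}"
proof
  fix z assume z: "z \<in> Poly_Mapping.keys (basis_mult w u)"
  obtain v where v: "distinct_adj v" "std v = z" by (rule std_surj)
  from z v have "card {(x, y) \<in> factorizations v. std x = w \<and> std y = u} \<noteq> 0"
    using lookup_basis_mult[OF v(1), of w u] by (metis in_keys_iff of_nat_0)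
  then have "{(x, y) \<in> factorizations v. std x = w \<and> std y = u} \<noteq> {}" by (metis card.empty)
  then obtain x y where xy: "(x, y) \<in> factorizations v" "std x = w" "std y = u" by auto
  then have "mdeg w = length x" "mdeg u = length y"
    by (auto simp: factorizations_def mdeg_std_distinct_adj)
  with factorizations_length(3)[OF xy(1)] v show "z \<in> {z. mdeg z \<le> mdeg w + mdeg u}"
    using mdeg_std_distinct_adj by auto
qed

text \<open>Double counting of the pairs \<open>(x, y)\<close> of reduced words that stand for
  \<open>w\<close> and \<open>u\<close> and whose product projects to \<open>p\<close> and
  \<open>q\<close>. Sorting the pairs by their product gives the left side; sorting them by the
  projections of \<open>x\<close> and \<open>y\<close> gives the right side, as the projections of a
  product are the products of the projections.\<close>

lemma MMR_comult_mult: "MMR_comult (MMR_mult a b) = tensor_mult MMR_mult (MMR_comult a) (MMR_comult b)"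
proof (rule bilinear_eqI[where f = "\<lambda>a b. MMR_comult (MMR_mult a b)"])
  show "additive (\<lambda>a. MMR_comult (MMR_mult a b))" "additive (\<lambda>b. MMR_comult (MMR_mult a b))" for a b
    by (rule additive_compose[OF additive_MMR_comult] additive_MMR_mult)+
  show "additive (\<lambda>a. tensor_mult MMR_mult (MMR_comult a) (MMR_comult b))" for b
    by (rule additive_compose[OF additive_tensor_mult(1) additive_MMR_comult])
  show "additive (\<lambda>b. tensor_mult MMR_mult (MMR_comult a) (MMR_comult b))" for a
    by (rule additive_compose[OF additive_tensor_mult(2) additive_MMR_comult])
  fix w u
  have "MMR_comult (basis_mult w u) = tensor_mult MMR_mult (basis_comult w) (basis_comult u)"
  proof (rule poly_mapping_eqI)
    fix PQ :: "mperm \<times> mperm"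
    obtain P Q where PQ: "PQ = (P, Q)" by force
    obtain p q k where p: "distinct_adj p" "\<And>l. l \<in> set p \<Longrightarrow> l < k" "std p = P"
      and q: "distinct_adj q" "\<And>l. l \<in> set q \<Longrightarrow> k \<le> l" "std q = Q"
      by (rule std_pair_surj) blast
    define N where "N = mdeg w + mdeg u"
    let ?V = "{v \<in> shuffles_of k p q. length v \<le> N}"
    let ?F = "\<lambda>v. {(x, y). (x, y) \<in> factorizations v \<and> std x = w \<and> std y = u}"
    let ?X = "\<lambda>p q. {x \<in> shuffles_of k p q. std x = w}"
    let ?Y = "\<lambda>p q. {y \<in> shuffles_of k p q. std y = u}"
    let ?FF = "factorizations p \<times> factorizations q"
    let ?XY = "\<lambda>f. ?X (fst (fst f)) (fst (snd f)) \<times> ?Y (snd (fst f)) (snd (snd f))"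
    define Z where "Z = {(x, y). distinct_adj x \<and> distinct_adj y \<and> std x = w \<and> std y = u
      \<and> remdups_adj (x @ y) \<in> shuffles_of k p q}"
    have finF: "finite (?F v)" for v
      by (rule finite_subset[OF _ finite_factorizations[of v]]) auto
    have finXY: "finite (?X p q)" "finite (?Y p q)" for p q
    proof -
      have "?X p q \<subseteq> {v \<in> shuffles_of k p q. length v \<le> mdeg w}"
        "?Y p q \<subseteq> {v \<in> shuffles_of k p q. length v \<le> mdeg u}"
        by (auto simp: shuffles_of_def mdeg_std_distinct_adj)
      then show "finite (?X p q)" "finite (?Y p q)"
        using finite_subset[OF _ finite_shuffles_of] by blast+
    qed
    have len: "length (remdups_adj (x @ y)) \<le> N"
      if "distinct_adj x" "distinct_adj y" "std x = w" "std y = u" for x y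
      using that remdups_adj_length[of "x @ y"] by (auto simp: N_def mdeg_std_distinct_adj)
    have "Poly_Mapping.lookup (MMR_comult (basis_mult w u)) (std p, std q)
        = (\<Sum>v\<in>?V. Poly_Mapping.lookup (basis_mult w u) (std v))"
      by (rule lookup_MMR_comult) (use p q keys_basis_mult[of w u] in \<open>auto simp: N_def\<close>)
    also have "\<dots> = (\<Sum>v\<in>?V. int (card (?F v)))"
      by (rule sum.cong) (auto simp: shuffles_of_def lookup_basis_mult intro!: arg_cong[where f = card])
    also have "\<dots> = int (card (SIGMA v:?V. ?F v))"
      using finF finite_shuffles_of by (subst card_SigmaI) auto
    also have "card (SIGMA v:?V. ?F v) = card Z"
    proof (rule bij_betw_same_card)
      \<comment> \<open>The word \<open>v\<close> is the product of \<open>x\<close> and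
        \<open>y\<close>, so forgetting it loses nothing.\<close>
      show "bij_betw snd (SIGMA v:?V. ?F v) Z"
        by (rule bij_betw_byWitness[where f' = "\<lambda>(x, y). (remdups_adj (x @ y), (x, y))"])
          (use len in \<open>auto simp: Z_def factorizations_def\<close>)
    qed
    also have "card Z = card (SIGMA f:?FF. ?XY f)"
    proof (rule bij_betw_same_card[symmetric])
      let ?lo = "\<lambda>x. remdups_adj (filter (\<lambda>l. l < k) x)"
      let ?hi = "\<lambda>x. remdups_adj (filter (\<lambda>l. k \<le> l) x)"
      have cat: "remdups_adj (?lo x @ ?lo y) = ?lo (remdups_adj (x @ y))"
        "remdups_adj (?hi x @ ?hi y) = ?hi (remdups_adj (x @ y))" for x y
        by (simp_all add: remdups_adj_append_left remdups_adj_append_right remdups_adj_filter)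
      \<comment> \<open>The two factorizations in the first component consist of the projections of
        \<open>x\<close> and \<open>y\<close>, so they too are determined by the pair.\<close>
      show "bij_betw snd (SIGMA f:?FF. ?XY f) Z"
      proof (rule bij_betw_byWitness[where f' = "\<lambda>(x, y). (((?lo x, ?lo y), (?hi x, ?hi y)), (x, y))"])
        show "snd ` (SIGMA f:?FF. ?XY f) \<subseteq> Z"
        proof
          fix z assume "z \<in> snd ` (SIGMA f:?FF. ?XY f)"
          then obtain p1 p2 q1 q2 x y where *: "((p1, p2), q1, q2) \<in> ?FF"
            "(x, y) \<in> ?XY ((p1, p2), q1, q2)" and z: "z = (x, y)" by force
          from *(2) have "?lo x = p1" "?lo y = p2" "?hi x = q1" "?hi y = q2"
            by (auto simp: shuffles_of_def)
          then have "?lo (remdups_adj (x @ y)) = p" "?hi (remdups_adj (x @ y)) = q"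
            using * unfolding cat[symmetric] by (auto simp: factorizations_def)
          then have "remdups_adj (x @ y) \<in> shuffles_of k p q"
            unfolding shuffles_of_def by simp
          then show "z \<in> Z"
            using * by (auto simp: z Z_def shuffles_of_def)
        qed
        show "(\<lambda>(x, y). (((?lo x, ?lo y), (?hi x, ?hi y)), (x, y))) ` Z \<subseteq> (SIGMA f:?FF. ?XY f)"
          by (auto simp: Z_def factorizations_def cat shuffles_of_def)
      qed (auto simp: shuffles_of_def)
    qed
    also have "int (card (SIGMA f:?FF. ?XY f)) = (\<Sum>f\<in>?FF. int (card (?XY f)))"
      using finXY finite_factorizations by (subst card_SigmaI) auto
    also have "\<dots> = (\<Sum>((p1, p2), (q1, q2))\<in>?FF. Poly_Mapping.lookup (basis_comult w) (std p1, std q1)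
        * Poly_Mapping.lookup (basis_comult u) (std p2, std q2))"
    proof (rule sum.cong[OF refl])
      fix f assume "f \<in> ?FF"
      then obtain p1 p2 q1 q2 where f: "(p1, p2) \<in> factorizations p" "(q1, q2) \<in> factorizations q"
        and f_eq: "f = ((p1, p2), (q1, q2))" by auto
      have d: "distinct_adj p1" "distinct_adj p2" "distinct_adj q1" "distinct_adj q2"
        using f by (auto simp: factorizations_def)
      have l: "l < k" if "l \<in> set p1 \<or> l \<in> set p2" for l
        using p(2) that factorizations_set[OF f(1)] by blast
      have h: "k \<le> l" if "l \<in> set q1 \<or> l \<in> set q2" for l
        using q(2) that factorizations_set[OF f(2)] by blast
      have "Poly_Mapping.lookup (basis_comult w) (std p1, std q1) = int (card (?X p1 q1))"
        by (rule lookup_basis_comult) (use d l h in auto)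
      moreover have "Poly_Mapping.lookup (basis_comult u) (std p2, std q2) = int (card (?Y p2 q2))"
        by (rule lookup_basis_comult) (use d l h in auto)
      ultimately show "int (card (?XY f)) = (\<lambda>((p1, p2), (q1, q2)).
          Poly_Mapping.lookup (basis_comult w) (std p1, std q1)
          * Poly_Mapping.lookup (basis_comult u) (std p2, std q2)) f"
        by (simp add: f_eq card_cartesian_product)
    qed
    also have "\<dots> = Poly_Mapping.lookup (tensor_mult MMR_mult (basis_comult w) (basis_comult u)) (std p, std q)"
      unfolding lookup_tensor_mult[OF p(1) q(1)] ..
    finally show "Poly_Mapping.lookup (MMR_comult (basis_mult w u)) PQ
      = Poly_Mapping.lookup (tensor_mult MMR_mult (basis_comult w) (basis_comult u)) PQ"
      unfolding PQ p(3) q(3) .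
  qed
  then show "MMR_comult (MMR_mult (frag_of w) (frag_of u))
    = tensor_mult MMR_mult (MMR_comult (frag_of w)) (MMR_comult (frag_of u))" by simp
qed

text \<open>Both sides are sums over two thresholds \<open>i \<le> j\<close> cutting
  \<open>x\<close> into three parts; they differ only in which threshold is chosen first.\<close>

lemma MMR_coassoc:
  "tensor_assoc (tensor_map MMR_comult id (MMR_comult a)) = tensor_map id MMR_comult (MMR_comult a)"
proof (rule additive_eqI[where f = "\<lambda>a. tensor_assoc (tensor_map MMR_comult id (MMR_comult a))"])
  show "additive (\<lambda>a. tensor_assoc (tensor_map MMR_comult id (MMR_comult a)))"
    by (intro additive_compose[OF additive_tensor_assoc] additive_compose[OF additive_tensor_map]
        additive_MMR_comult)
  show "additive (\<lambda>a. tensor_map id MMR_comult (MMR_comult a))"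
    by (rule additive_compose[OF additive_tensor_map additive_MMR_comult])
  fix w
  define K where "K = length (word_of w)"
  obtain x where x: "std x = w" "set x = {0..<K}"
    unfolding K_def by (rule std_surj)
  let ?s = "\<lambda>P. std (filter P x)"
  have left: "basis_comult (?s (\<lambda>l. l < j)) = (\<Sum>i\<in>{0..j}. frag_of (?s (\<lambda>l. l < i), ?s (\<lambda>l. i \<le> l \<and> l < j)))"
    if "j \<in> {0..K}" for j
  proof -
    have "set (filter (\<lambda>l. l < j) x) = {0..<j}" using that x(2) by auto
    note * = basis_comult_std[OF this le0]
    have "filter (\<lambda>l. l < i) (filter (\<lambda>l. l < j) x) = filter (\<lambda>l. l < i) x"
      "filter (\<lambda>l. i \<le> l) (filter (\<lambda>l. l < j) x) = filter (\<lambda>l. i \<le> l \<and> l < j) x"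
      if "i \<in> {0..j}" for i
      unfolding filter_filter using that by (auto intro: filter_cong)
    then show ?thesis unfolding * by (intro sum.cong[OF refl]) (simp only:)
  qed
  have right: "basis_comult (?s (\<lambda>l. i \<le> l)) = (\<Sum>j\<in>{i..K}. frag_of (?s (\<lambda>l. i \<le> l \<and> l < j), ?s (\<lambda>l. j \<le> l)))"
    if "i \<in> {0..K}" for i
  proof -
    have "set (filter (\<lambda>l. i \<le> l) x) = {i..<K}" "i \<le> K" using that x(2) by auto
    note * = basis_comult_std[OF this]
    have "filter (\<lambda>l. l < j) (filter (\<lambda>l. i \<le> l) x) = filter (\<lambda>l. i \<le> l \<and> l < j) x"
      "filter (\<lambda>l. j \<le> l) (filter (\<lambda>l. i \<le> l) x) = filter (\<lambda>l. j \<le> l) x"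
      if "j \<in> {i..K}" for j
      unfolding filter_filter using that by (auto intro: filter_cong)
    then show ?thesis unfolding * by (intro sum.cong[OF refl]) (simp only:)
  qed
  have w: "MMR_comult (frag_of w) = (\<Sum>j\<in>{0..K}. frag_of (?s (\<lambda>l. l < j), ?s (\<lambda>l. j \<le> l)))"
    using basis_comult_std[OF x(2) le0] x(1) by simp
  have "tensor_assoc (tensor_map MMR_comult id (MMR_comult (frag_of w)))
    = (\<Sum>j\<in>{0..K}. \<Sum>i\<in>{0..j}. frag_of (?s (\<lambda>l. l < i), (?s (\<lambda>l. i \<le> l \<and> l < j), ?s (\<lambda>l. j \<le> l))))"
    unfolding w additive.sum[OF additive_tensor_map] additive.sum[OF additive_tensor_assoc]
    by (rule sum.cong) (simp_all add: tensor_map_of left additive.sum[OF additive_tensor_left]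
        additive.sum[OF additive_tensor_assoc])
  also have "\<dots> = (\<Sum>(j, i)\<in>(SIGMA j:{0..K}. {0..j}).
      frag_of (?s (\<lambda>l. l < i), (?s (\<lambda>l. i \<le> l \<and> l < j), ?s (\<lambda>l. j \<le> l))))"
    by (rule sum.Sigma) simp_all
  also have "\<dots> = (\<Sum>(i, j)\<in>(SIGMA i:{0..K}. {i..K}).
      frag_of (?s (\<lambda>l. l < i), (?s (\<lambda>l. i \<le> l \<and> l < j), ?s (\<lambda>l. j \<le> l))))"
    by (rule sum.reindex_bij_witness[of _ prod.swap prod.swap]) auto
  also have "\<dots> = (\<Sum>i\<in>{0..K}. \<Sum>j\<in>{i..K}.
      frag_of (?s (\<lambda>l. l < i), (?s (\<lambda>l. i \<le> l \<and> l < j), ?s (\<lambda>l. j \<le> l))))"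
    by (rule sum.Sigma[symmetric]) simp_all
  also have "\<dots> = tensor_map id MMR_comult (MMR_comult (frag_of w))"
    unfolding w additive.sum[OF additive_tensor_map]
    by (rule sum.cong) (simp_all add: tensor_map_of right additive.sum[OF additive_tensor_right])
  finally show "tensor_assoc (tensor_map MMR_comult id (MMR_comult (frag_of w)))
    = tensor_map id MMR_comult (MMR_comult (frag_of w))" .
qed

lemma MMR_counit_of: "MMR_counit (frag_of (std x)) = (if x = [] then 1 else 0)"
  using std_eq_Nil_iff[of x] by (auto simp: MMR_counit_def mperm_of_Nil lookup_single when_def)

lemma additive_MMR_counit: "additive MMR_counit"
  unfolding MMR_counit_def by (rule additive_lookup)

text \<open>Every level below \<open>K\<close> occurs in \<open>x\<close>, so the left part is empty
  only for the cut at 0 and the right part only for the cut at \<open>K\<close>.\<close>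

lemma MMR_counit_comult:
  "tensor_lift (\<lambda>x y. frag_cmul (MMR_counit x) y) (MMR_comult a) = a" (is "?left a = a")
  "tensor_lift (\<lambda>x y. frag_cmul (MMR_counit y) x) (MMR_comult a) = a" (is "?right a = a")
proof -
  have *: "?left (frag_of w) = frag_of w" "?right (frag_of w) = frag_of w" for w
  proof -
    define K where "K = length (word_of w)"
    obtain x where x: "std x = w" "set x = {0..<K}"
      unfolding K_def by (rule std_surj)
    have w: "MMR_comult (frag_of w)
        = (\<Sum>j\<in>{0..K}. frag_of (std (filter (\<lambda>l. l < j) x), std (filter (\<lambda>l. j \<le> l) x)))"
      using basis_comult_std[OF x(2) le0] x(1) by simp
    have lo: "filter (\<lambda>l. l < j) x = [] \<longleftrightarrow> j = 0" if "j \<in> {0..K}" for j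
      using that x(2) by (auto simp: filter_empty_conv)
    have hi: "filter (\<lambda>l. j \<le> l) x = [] \<longleftrightarrow> j = K" if "j \<in> {0..K}" for j
      using that x(2) by (auto simp: filter_empty_conv not_le)
    have all: "filter (\<lambda>l. l < K) x = x" using x(2) by (auto intro: filter_True)
    have "?left (frag_of w) = (\<Sum>j\<in>{0..K}. if j = 0 then frag_of w else 0)"
      unfolding w additive.sum[OF additive_tensor_lift]
      by (rule sum.cong) (auto simp: MMR_counit_of lo x(1))
    then show "?left (frag_of w) = frag_of w" by simp
    have "?right (frag_of w) = (\<Sum>j\<in>{0..K}. if j = K then frag_of w else 0)"
      unfolding w additive.sum[OF additive_tensor_lift]
      by (rule sum.cong) (auto simp: MMR_counit_of hi all x(1))
    then show "?right (frag_of w) = frag_of w" by simp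
  qed
  show "?left a = a" "?right a = a"
    by (rule additive_eqI[OF additive_compose[OF additive_tensor_lift additive_MMR_comult] additive_id(2) *(1)])
      (rule additive_eqI[OF additive_compose[OF additive_tensor_lift additive_MMR_comult] additive_id(2) *(2)])
qed

lemma MMR_bialgebra: "free_bialgebra MMR_mult MMR_unit MMR_comult MMR_counit"
proof unfold_locales
  show "MMR_mult (MMR_unit 1) a = a" "MMR_mult a (MMR_unit 1) = a" for a
    by (rule MMR_mult_unit)+
  show "MMR_comult (MMR_unit 1) = tensor (MMR_unit 1) (MMR_unit 1)"
    using basis_comult_std[of "[]" 0 0] by (simp add: MMR_unit_1)
  \<comment> \<open>The coefficient of the empty word in a product sees only the factorization into
    two empty words.\<close>
  show "MMR_counit (MMR_mult a b) = MMR_counit a * MMR_counit b" for a b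
    using lookup_MMR_mult[of "[]" a b] by (simp add: MMR_counit_def mperm_of_Nil factorizations_Nil)
  show "MMR_counit (MMR_unit 1) = 1"
    by (simp add: MMR_unit_1 MMR_counit_of)
qed (simp_all add: additive.add[OF additive_MMR_mult(1)] additive.add[OF additive_MMR_mult(2)]
    additive.add[OF additive_MMR_comult] additive.add[OF additive_MMR_counit]
    MMR_unit_def frag_cmul_distrib MMR_mult_assoc MMR_coassoc MMR_counit_comult MMR_comult_mult)

text \<open>A nonempty right part means that the cut \<open>j\<close> is below \<open>K\<close>, and
  the left part then has \<open>j\<close> of the \<open>K\<close> blocks.\<close>

lemma keys_basis_comult:
  assumes "(y, z) \<in> Poly_Mapping.keys (basis_comult w)" "z \<noteq> std []"
  shows "length (word_of y) < length (word_of w)"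
proof -
  define K where "K = length (word_of w)"
  obtain x where x: "std x = w" "set x = {0..<K}"
    unfolding K_def by (rule std_surj)
  have "(y, z) \<in> (\<Union>j\<in>{0..K}. Poly_Mapping.keys (frag_of (std (filter (\<lambda>l. l < j) x), std (filter (\<lambda>l. j \<le> l) x))))"
    using assms(1) keys_sum[of "\<lambda>j. frag_of (std (filter (\<lambda>l. l < j) x), std (filter (\<lambda>l. j \<le> l) x))" "{0..K}"]
    unfolding x(1)[symmetric] basis_comult_std[OF x(2) le0] by blast
  then obtain j where j: "j \<le> K" "y = std (filter (\<lambda>l. l < j) x)" "z = std (filter (\<lambda>l. j \<le> l) x)"
    by (auto simp: keys_frag_of)
  have "j \<noteq> K" using assms(2) j(3) x(2) by (auto simp: std_eq_Nil_iff filter_empty_conv)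
  moreover have "set (filter (\<lambda>l. l < j) x) = {0..<j}" using j(1) x(2) by auto
  ultimately show ?thesis
    using j by (simp add: length_word_of_std K_def[symmetric])
qed

theorem proposition7p8:
  shows "\<exists>S :: MMR \<Rightarrow> MMR. free_Hopf_algebra MMR_mult MMR_unit MMR_comult MMR_counit S"
proof -
  interpret free_bialgebra MMR_mult MMR_unit MMR_comult MMR_counit
    by (rule MMR_bialgebra)
  interpret connected_bialgebra MMR_mult MMR_unit MMR_comult MMR_counit "std []" "\<lambda>w. length (word_of w)"
  proof
    show "MMR_unit 1 = frag_of (std [])" by (rule MMR_unit_1)
    show "MMR_counit (frag_of w) = 0" if "w \<noteq> std []" for w
      using that by (simp add: MMR_counit_def mperm_of_Nil lookup_single)
    show "length (word_of y) < length (word_of w)"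
      if "(y, z) \<in> Poly_Mapping.keys (MMR_comult (frag_of w))" "z \<noteq> std []" for w y z
      using that keys_basis_comult by simp
  qed
  show ?thesis by (rule antipode_exists)
qed

end
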